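(* Let $\mu$ be a compound Poisson distribution with Lévy measure $\lambda G$, where $\lambda>0$ and $G$ is a probability distribution on $\mathbb R$. Then the following are equivalent: (i) $\mu\in\mathcal S_{loc}\cap\mathcal D_{loc}$; (ii) $G\in\mathcal S_{loc}\cap\mathcal D_{loc}$; (iii) $G\in\mathcal L_{loc}\cap\mathcal D_{loc}$ and $\lim_{x\to\infty}\mu(x+\Delta)/G(x+\Delta)=\lambda$ for every $\Delta=(0,c]$, $c>0$. If additionally $G$ is a distribution on $\mathbb R_+=[0,\infty)$, then the following are equivalent: (i) $\mu\in\mathcal S_{loc}$; (ii) $G\in\mathcal S_{loc}$; (iii) $G\in\mathcal L_{loc}$ and $\lim_{x\to\infty}\mu(x+\Delta)/G(x+\Delta)=\lambda$ for every $\Delta=(0,c]$, $c>0$.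
   Context: The compound Poisson distribution with Lévy measure $\lambda G$ is $\mu=e^{-\lambda}\sum_{n\ge0}(\lambda^n/n!)G^{*n}$, where $G^{*n}$ is the $n$-fold convolution and $G^{*0}$ is the Dirac measure at $0$. For $\Delta=(0,c]$ and a distribution $F$ on $\mathbb R$, $F(x+\Delta):=F((x,x+c])$. $\alpha(x)\sim\beta(x)$ means $\alpha(x)/\beta(x)\to1$ as $x\to\infty$. A non-negative measurable function $\alpha$ belongs to $\mathcal L$ if there is $x_0>0$ with $\alpha(x)>0$ for $x\ge x_0$ and, for every fixed $y>0$, $\alpha(x+y)\sim\alpha(x)$. $F\in\mathcal L_\Delta$ if the function $x\mapsto F(x+\Delta)$ is in $\mathcal L$. $F\in\mathcal S_\Delta$ if $F\in\mathcal L_\Delta$ and $F^{*2}(x+\Delta)\sim 2F(x+\Delta)$. A function $\alpha:\mathbb R\to\mathbb R_+$ is almost decreasing if there exist $x_0>0$ and $K>0$ such that $\alpha(x+y)\le K\alpha(x)$ for all $x>x_0$, $y>0$. $F\in\mathcal D_\Delta$ if $x\mapsto F(x+\Delta)$ is almost decreasing. $F\in\mathcal L_{loc}$ (resp. $\mathcal S_{loc}$, $\mathcal D_{loc}$) if $F\in\mathcal L_\Delta$ (resp. $\mathcal S_\Delta$, $\mathcal D_\Delta$) for all $\Delta=(0,c]$ with $c>0$. *)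

theory Defs
  imports "HOL-Probability.Probability"
begin

primrec conv_power :: "real measure \<Rightarrow> nat \<Rightarrow> real measure" where
  "conv_power F 0 = return borel 0"
| "conv_power F (Suc n) = convolution F (conv_power F n)"

lemma real_distribution_convolution:
  assumes "real_distribution F" "real_distribution G"
  shows "real_distribution (convolution F G)"
proof -
  interpret F: real_distribution F by fact
  interpret G: real_distribution G by fact
  interpret P: pair_prob_space F G ..
  show ?thesis
    unfolding convolution_def by (rule P.real_distribution_distr) measurable
qed

lemma real_distribution_conv_power:
  assumes "real_distribution F"
  shows "real_distribution (conv_power F n)"
proof (induction n)
  case 0
  show ?case
    by (simp add: real_distribution_def real_distribution_axioms_def prob_space_return)
next
  case (Suc n)
  then show ?case using assms by (simp add: real_distribution_convolution)
qed

lemma conv_power_1: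
  assumes "real_distribution F"
  shows "conv_power F 1 = F"
proof (rule measure_eqI)
  interpret F: real_distribution F by fact
  show "sets (conv_power F 1) = sets F" by simp
  fix A :: "real set" assume "A \<in> sets (conv_power F 1)"
  then have [measurable]: "A \<in> sets borel" by simp
  have fm: "finite_measure (return borel (0::real))"
    by (simp add: prob_space_return prob_space.finite_measure)
  have "emeasure (conv_power F 1) A = (\<integral>\<^sup>+x. indicator A x \<partial>F)"
    by (simp add: convolution_emeasure' F.finite_measure_axioms fm nn_integral_return)
  then show "emeasure (conv_power F 1) A = emeasure F A" by simp
qed

lemma conv_power_2:
  assumes "real_distribution F"
  shows "conv_power F 2 = convolution F F"
  using conv_power_1[OF assms] by (simp add: numeral_2_eq_2)

definition compound_poisson :: "real \<Rightarrow> real measure \<Rightarrow> real measure" where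
  "compound_poisson l G = measure_of UNIV (sets borel)
     (\<lambda>A. ennreal (exp (- l)) * (\<Sum>n. ennreal (l ^ n / fact n) * emeasure (conv_power G n) A))"

text \<open>The set function passed to \<^const>\<open>measure_of\<close> is countably additive, so that it does
  give the values of the measure.\<close>

lemma emeasure_compound_poisson:
  assumes "real_distribution G" "A \<in> sets borel"
  shows "emeasure (compound_poisson l G) A =
    ennreal (exp (- l)) * (\<Sum>n. ennreal (l ^ n / fact n) * emeasure (conv_power G n) A)"
    (is "_ = ?\<mu> A")
proof (rule emeasure_measure_of[OF compound_poisson_def])
  have sets: "sets (conv_power G n) = sets borel" for n
    using real_distribution_conv_power[OF assms(1)] by (simp add: real_distribution.events_eq_borel)
  have sets_cp: "sets (compound_poisson l G) = sets borel"
    unfolding compound_poisson_def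
    by (metis sets.sigma_sets_eq sets_measure_of space_borel sets.space_closed)
  show "sets borel \<subseteq> Pow UNIV" by simp
  show "A \<in> sets (compound_poisson l G)" using assms(2) sets_cp by simp
  show "positive (sets (compound_poisson l G)) ?\<mu>" by (simp add: positive_def)
  show "countably_additive (sets (compound_poisson l G)) ?\<mu>"
  proof (rule countably_additiveI)
    fix B :: "nat \<Rightarrow> real set"
    assume B: "range B \<subseteq> sets (compound_poisson l G)" "disjoint_family B"
    let ?a = "\<lambda>n. ennreal (l ^ n / fact n)" and ?e = "\<lambda>n. emeasure (conv_power G n)"
    have "(\<Sum>i. ?\<mu> (B i)) = ennreal (exp (- l)) * (\<Sum>i. \<Sum>n. ?a n * ?e n (B i))"
      by simp
    also have "(\<Sum>i. \<Sum>n. ?a n * ?e n (B i)) = (\<Sum>n. \<Sum>i. ?a n * ?e n (B i))"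
      using nn_integral_suminf[of "\<lambda>n i. ?a n * ?e n (B i)" "count_space UNIV"]
      by (simp add: nn_integral_count_space_nat)
    also have "\<dots> = (\<Sum>n. ?a n * ?e n (\<Union>i. B i))"
      using B by (simp add: suminf_emeasure sets sets_cp)
    finally show "(\<Sum>i. ?\<mu> (B i)) = ?\<mu> (\<Union>i. B i)" .
  qed
qed

definition L_fun :: "(real \<Rightarrow> real) set" where
  "L_fun = {\<alpha>. \<alpha> \<in> borel_measurable borel \<and> (\<forall>x. 0 \<le> \<alpha> x) \<and>
     (\<exists>x0>0. \<forall>x\<ge>x0. 0 < \<alpha> x) \<and>
     (\<forall>y>0. (\<lambda>x. \<alpha> (x + y)) \<sim>[at_top] \<alpha>)}"

definition almost_decreasing :: "(real \<Rightarrow> real) \<Rightarrow> bool" where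
  "almost_decreasing \<alpha> \<longleftrightarrow> (\<forall>x. 0 \<le> \<alpha> x) \<and>
     (\<exists>x0>0. \<exists>K>0. \<forall>x>x0. \<forall>y>0. \<alpha> (x + y) \<le> K * \<alpha> x)"

definition local_mass :: "real measure \<Rightarrow> real \<Rightarrow> real \<Rightarrow> real" where
  "local_mass F c x = measure F {x<..x + c}"

text \<open>The index \<open>c\<close> of the following classes stands for the interval \<open>\<Delta> = (0, c]\<close>.\<close>

definition L_Delta :: "real \<Rightarrow> real measure set" where
  "L_Delta c = {F. real_distribution F \<and> local_mass F c \<in> L_fun}"

definition S_Delta :: "real \<Rightarrow> real measure set" where
  "S_Delta c = {F \<in> L_Delta c.
     local_mass (conv_power F 2) c \<sim>[at_top] (\<lambda>x. 2 * local_mass F c x)}"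

definition D_Delta :: "real \<Rightarrow> real measure set" where
  "D_Delta c = {F. real_distribution F \<and> almost_decreasing (local_mass F c)}"

definition L_loc :: "real measure set" where
  "L_loc = (\<Inter>c\<in>{0<..}. L_Delta c)"

definition S_loc :: "real measure set" where
  "S_loc = (\<Inter>c\<in>{0<..}. S_Delta c)"

definition D_loc :: "real measure set" where
  "D_loc = (\<Inter>c\<in>{0<..}. D_Delta c)"

end

theory Submission
  imports Defs
begin

text \<open>
  Fix \<open>\<Delta> = (0, c]\<close>. For a reference distribution \<open>M\<close> with \<open>\<alpha> x = M(x + \<Delta>)\<close>, the mass
  \<open>(F * N)(x + \<Delta>)\<close> of a convolution splits, for \<open>x \<ge> 2B\<close>, into the event that the second summand is at
  most \<open>B\<close>, the event that the first is at most \<open>B\<close>, and the event that both exceed \<open>B\<close>. If \<open>F\<close> and \<open>N\<close>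
  have local masses asymptotic to \<open>a \<alpha>\<close> and \<open>b \<alpha>\<close>, dominated convergence turns the first two parts into
  \<open>a N(-\<infinity>, B]\<close> and \<open>b F(-\<infinity>, B]\<close>. The third part, the joint tail, is negligible as \<open>B\<close> grows if this
  holds for \<open>M\<close> with itself, and for \<open>M\<close> it is the condition \<open>M * M \<sim> 2M\<close>. Domination requires a bound
  of \<open>\<alpha>(x - y) / \<alpha> x\<close> that is uniform in \<open>y \<le> B\<close>. Bounded \<open>y\<close> are harmless because \<open>M\<close> is long-tailed;
  negative \<open>y\<close> are handled by almost decrease in the two-sided case and do not occur on the half-line.
  Both cases are treated together by a set \<open>S\<close>, either the line or the half-line, that carries all
  distributions.

  (ii) implies (i) and (iii): if \<open>G\<close> is subexponential then \<open>G\<^sup>n \<sim> n G\<close>, and a geometric bound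
  \<open>G\<^sup>n(x + \<Delta>) \<le> K\<^sup>n G(x + \<Delta>)\<close>, summable against \<open>\<lambda>\<^sup>n / n!\<close>, allows the limit to be taken in the
  compound Poisson series term by term (\<open>ratio_compound_poisson_tendsto\<close>). The same limit for \<open>2\<lambda>\<close>
  describes \<open>\<mu> * \<mu>\<close>.

  (iii) implies (ii): the splitting without its joint tail gives \<open>liminf G\<^sup>n / G \<ge> n\<close>. Since the means
  \<open>n \<lambda>\<^sup>n e\<^sup>-\<^sup>\<lambda> / n!\<close> add up to exactly \<open>\<lambda>\<close>, no term of the series may exceed its lower bound in the limit,
  in particular not the term \<open>n = 2\<close> (\<open>self_convolution_of_compound_poisson\<close>).

  (i) implies (iii) is the delicate part, since nothing is known about \<open>G\<close> itself. Write \<open>\<mu>\<^sub>t\<close> for the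
  compound Poisson distribution with Levy measure \<open>t G\<close>. Then \<open>\<mu>\<^sub>2\<^sub>t = \<mu>\<^sub>t * \<mu>\<^sub>t\<close>, and \<open>\<mu>\<^sub>t \<le> e\<^sup>t \<mu>\<^sub>2\<^sub>t\<close> as
  measures, so that the splitting applies to \<open>\<mu>\<^sub>2\<^sub>t\<close>: the functions \<open>g\<^sub>x(y) = \<mu>\<^sub>t(x - y + \<Delta>) / \<mu>\<^sub>2\<^sub>t(x + \<Delta>)\<close>
  have \<open>\<mu>\<^sub>t\<close>-averages \<open>\<integral> g\<^sub>x(z + y) \<mu>\<^sub>t(dy)\<close> that tend to \<open>1/2\<close> for all \<open>z \<in> S\<close>. Averaging over \<open>\<mu>\<^sub>t\<close> can be
  undone: \<open>\<mu>\<^sub>t\<close> has the finite signed measure \<open>e\<^sup>t exp(-t G)\<close> as convolution inverse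
  (\<open>compound_poisson_inversion\<close>), so \<open>g\<^sub>x(0)\<close> itself tends to \<open>1/2\<close> (\<open>half_ratio_tendsto\<close>). Hence
  \<open>\<mu>\<^sub>t \<sim> \<mu>\<^sub>2\<^sub>t / 2\<close>, and \<open>\<mu>\<^sub>t\<close> is again subexponential. Iterating, \<open>\<mu>\<^sub>\<lambda>\<^sub>/\<^sub>n \<sim> \<mu> / n\<close> for \<open>n = 2\<^sup>k\<close>. Finally,
  away from \<open>0\<close> the measure \<open>e\<^sup>\<lambda>\<^sup>/\<^sup>n \<mu>\<^sub>\<lambda>\<^sub>/\<^sub>n\<close> differs from \<open>(\<lambda>/n) G\<close> by at most \<open>e\<^sup>\<lambda> \<mu> / n\<^sup>2\<close>, and letting
  \<open>n\<close> grow gives \<open>\<lambda> G \<sim> \<mu>\<close> (\<open>levy_measure_ratio_tendsto\<close>).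
\<close>

section \<open>Exponential series with shifted coefficients\<close>

lemma exp_sums_divide: "(\<lambda>n. x ^ n / fact n) sums exp (x::real)"
  using exp_converges[of x] unfolding real_scaleR_def divide_inverse by (simp only: mult.commute)

lemma poisson_mean_sums: "(\<lambda>n. l ^ n / fact n * real n) sums (l * exp (l::real))"
proof -
  have "l * (l ^ n / fact n) = l ^ Suc n / fact (Suc n) * real (Suc n)" for n
    by (simp add: divide_simps del: of_nat_Suc)
  moreover have "(\<lambda>n. l * (l ^ n / fact n)) sums (l * exp l)"
    by (intro sums_mult exp_sums_divide)
  ultimately have "(\<lambda>n. l ^ Suc n / fact (Suc n) * real (Suc n)) sums (l * exp l)"
    by (simp only:)
  then show ?thesis by (subst (asm) sums_Suc_iff) simp
qed

lemma bounded_exp_series_summable: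
  fixes b :: "nat \<Rightarrow> real"
  assumes "\<And>n. \<bar>b n\<bar> \<le> K"
  shows "summable (\<lambda>n. norm (s ^ n / fact n * b n))"
proof (rule summable_comparison_test')
  show "summable (\<lambda>n. K * (\<bar>s\<bar> ^ n / fact n))"
    by (intro summable_mult sums_summable[OF exp_sums_divide])
  show "norm (norm (s ^ n / fact n * b n)) \<le> K * (\<bar>s\<bar> ^ n / fact n)" for n
    using mult_right_mono[OF assms[of n], of "\<bar>s\<bar> ^ n / fact n"]
    by (simp add: abs_mult power_abs mult.commute)
qed

text \<open>
  This is \<open>exp(sT) exp(tT) = exp((s + t)T)\<close> for the shift \<open>T\<close> acting on bounded sequences, evaluated at
  index \<open>0\<close>. With \<open>b n\<close> the integral of a function against the \<open>n\<close>-th convolution power, positive \<open>s\<close>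
  and \<open>t\<close> give the convolution semigroup of compound Poisson distributions, and \<open>s = -t\<close> gives the
  convolution inverse.
\<close>

lemma exp_series_shift_sums:
  fixes b :: "nat \<Rightarrow> real" and s t :: real
  assumes b: "\<And>n. \<bar>b n\<bar> \<le> K"
  shows "(\<lambda>m. s ^ m / fact m * (\<Sum>n. t ^ n / fact n * b (m + n))) sums
    (\<Sum>j. (s + t) ^ j / fact j * b j)"
proof -
  define f where "f = (\<lambda>(m::nat, n::nat). s ^ m / fact m * (t ^ n / fact n * b (m + n)))"
  have K: "0 \<le> K" using b[of 0] by linarith
  have inner: "((\<lambda>n. f (m, n)) has_sum s ^ m / fact m * (\<Sum>n. t ^ n / fact n * b (m + n))) UNIV" for m
    unfolding f_def prod.case
    by (intro has_sum_cmult_right norm_summable_imp_has_sum summable_sums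
          bounded_exp_series_summable[where K = K]
          summable_norm_cancel[OF bounded_exp_series_summable[where K = K]] b)
  have "(\<lambda>(m, n). (\<bar>s\<bar> ^ m / fact m) * (K * (\<bar>t\<bar> ^ n / fact n))) summable_on UNIV \<times> UNIV"
  proof (rule summable_on_SigmaI)
    show "((\<lambda>n. case (m, n) of (m, n) \<Rightarrow> \<bar>s\<bar> ^ m / fact m * (K * (\<bar>t\<bar> ^ n / fact n))) has_sum
        \<bar>s\<bar> ^ m / fact m * (K * exp \<bar>t\<bar>)) UNIV" for m :: nat
      unfolding prod.case
      by (intro has_sum_cmult_right sums_nonneg_imp_has_sum exp_sums_divide) simp
    show "(\<lambda>m. \<bar>s\<bar> ^ m / fact m * (K * exp \<bar>t\<bar>)) summable_on UNIV"
      using sums_summable[OF exp_sums_divide[of "\<bar>s\<bar>"]]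
      by (intro summable_on_cmult_left norm_summable_imp_summable_on) simp
  qed (use K in auto)
  then have "(\<lambda>x. norm (f x)) summable_on UNIV \<times> UNIV"
    by (rule Infinite_Sum.abs_summable_on_comparison_test')
      (auto simp: f_def abs_mult power_abs mult.commute[of K] intro!: mult_left_mono divide_right_mono b)
  then have fs: "f summable_on UNIV \<times> UNIV"
    by (rule Infinite_Sum.abs_summable_summable)
  then obtain T where T: "(f has_sum T) (UNIV \<times> UNIV)" by (auto simp: summable_on_def)
  have "((\<lambda>m. s ^ m / fact m * (\<Sum>n. t ^ n / fact n * b (m + n))) has_sum T) UNIV"
    by (rule has_sum_SigmaD[OF T]) (rule inner)
  then have 1: "(\<lambda>m. s ^ m / fact m * (\<Sum>n. t ^ n / fact n * b (m + n))) sums T"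
    by (rule has_sum_imp_sums)
  (* Resummation along the antidiagonals m + n = j, where the binomial theorem applies. *)
  have bij: "bij_betw (\<lambda>(j, m). (m, j - m)) (SIGMA j:UNIV. {..j}) (UNIV \<times> (UNIV::nat set))"
    by (rule bij_betwI[where g = "\<lambda>(m, n). (m + n, m)"]) auto
  have "((\<lambda>x. f (case x of (j, m) \<Rightarrow> (m, j - m))) has_sum T) (SIGMA j:UNIV. {..j})"
    using T by (subst has_sum_reindex_bij_betw[OF bij])
  then have "((\<lambda>j. (s + t) ^ j / fact j * b j) has_sum T) UNIV"
  proof (rule has_sum_SigmaD)
    fix j :: nat
    have "(\<Sum>m\<le>j. f (m, j - m)) = (s + t) ^ j / fact j * b j"
      by (auto simp: f_def binomial_ring sum_divide_distrib sum_distrib_right binomial_fact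
            intro!: sum.cong)
    then show "((\<lambda>m. f (case (j, m) of (j, m) \<Rightarrow> (m, j - m))) has_sum (s + t) ^ j / fact j * b j) {..j}"
      by (metis (no_types, lifting) case_prod_conv finite_atMost has_sum_cong has_sum_finite)
  qed
  then have "(\<lambda>j. (s + t) ^ j / fact j * b j) sums T" by (rule has_sum_imp_sums)
  with 1 show ?thesis by (simp add: sums_iff)
qed

section \<open>Convolutions of probability distributions on the line\<close>

lemma real_distribution_return: "real_distribution (return borel (x::real))"
  by (simp add: real_distribution_def real_distribution_axioms_def prob_space_return)

lemma integrable_real_distribution_bounded:
  fixes h :: "real \<Rightarrow> real"
  assumes "real_distribution F" "h \<in> borel_measurable borel" "\<And>x. \<bar>h x\<bar> \<le> K"
  shows "integrable F h"
proof -
  interpret real_distribution F by fact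
  show ?thesis
    by (rule integrable_const_bound[of _ K]) (use assms in auto)
qed

lemma abs_integral_real_distribution_le:
  fixes h :: "real \<Rightarrow> real"
  assumes "real_distribution F" "h \<in> borel_measurable borel" "\<And>x. \<bar>h x\<bar> \<le> K"
  shows "\<bar>\<integral>x. h x \<partial>F\<bar> \<le> K"
proof -
  interpret real_distribution F by fact
  have i: "integrable F h" by (rule integrable_real_distribution_bounded[OF assms])
  have "\<bar>\<integral>x. h x \<partial>F\<bar> \<le> (\<integral>x. \<bar>h x\<bar> \<partial>F)" by (rule integral_abs_bound)
  also have "\<dots> \<le> (\<integral>x. K \<partial>F)"
    using i assms(3) by (intro integral_mono) auto
  finally show ?thesis using prob_space by simp
qed

lemma
  fixes h :: "real \<Rightarrow> real"
  assumes F1: "real_distribution F1" and F2: "real_distribution F2"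
    and h [measurable]: "h \<in> borel_measurable borel" and K: "\<And>x. \<bar>h x\<bar> \<le> K"
  shows integral_convolution_real:
      "(\<integral>x. h x \<partial>convolution F1 F2) = (\<integral>x. (\<integral>y. h (x + y) \<partial>F2) \<partial>F1)"
    and integral_convolution_real_swap:
      "(\<integral>x. h x \<partial>convolution F1 F2) = (\<integral>y. (\<integral>x. h (x + y) \<partial>F1) \<partial>F2)"
    and borel_measurable_integral_translate:
      "(\<lambda>x. \<integral>y. h (x + y) \<partial>F2) \<in> borel_measurable borel"
proof -
  interpret F1: real_distribution F1 by fact
  interpret F2: real_distribution F2 by fact
  interpret P: pair_prob_space F1 F2 ..
  have i: "integrable (F1 \<Otimes>\<^sub>M F2) (\<lambda>(x, y). h (x + y))"
    by (rule P.integrable_const_bound[of _ K]) (use K in \<open>auto simp: split_beta'\<close>)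
  have e: "(\<integral>x. h x \<partial>convolution F1 F2) = (\<integral>z. (case z of (x, y) \<Rightarrow> h (x + y)) \<partial>(F1 \<Otimes>\<^sub>M F2))"
    unfolding convolution_def by (subst integral_distr) (auto simp: split_beta')
  show "(\<integral>x. h x \<partial>convolution F1 F2) = (\<integral>x. (\<integral>y. h (x + y) \<partial>F2) \<partial>F1)"
    using P.integral_fst'[OF i] e by simp
  show "(\<integral>x. h x \<partial>convolution F1 F2) = (\<integral>y. (\<integral>x. h (x + y) \<partial>F1) \<partial>F2)"
    using P.integral_snd[of "\<lambda>x y. h (x + y)"] i e by (simp add: split_beta')
  show "(\<lambda>x. \<integral>y. h (x + y) \<partial>F2) \<in> borel_measurable borel"
    by (rule F2.borel_measurable_lebesgue_integral) measurable
qed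

lemma convolution_commute_real:
  assumes "real_distribution F1" "real_distribution F2"
  shows "convolution F1 F2 = convolution F2 F1"
proof -
  interpret F1: real_distribution F1 by fact
  interpret F2: real_distribution F2 by fact
  show ?thesis
    by (rule convolution_commutative) (auto intro: F1.finite_measure_axioms F2.finite_measure_axioms)
qed

lemma convolution_assoc_real:
  assumes "real_distribution F1" "real_distribution F2" "real_distribution F3"
  shows "convolution F1 (convolution F2 F3) = convolution (convolution F1 F2) F3"
proof -
  interpret F1: real_distribution F1 by fact
  interpret F2: real_distribution F2 by fact
  interpret F3: real_distribution F3 by fact
  show ?thesis
    by (rule convolution_associative)
      (auto intro: F1.finite_measure_axioms F2.finite_measure_axioms F3.finite_measure_axioms)
qed

lemma measure_eq_integral_indicator:
  assumes "real_distribution F" "A \<in> sets borel"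
  shows "measure F A = (\<integral>x. indicator A x \<partial>F)"
proof -
  interpret real_distribution F by fact
  show ?thesis using assms(2) by simp
qed

lemma real_distribution_eqI:
  assumes F1: "real_distribution F1" and F2: "real_distribution F2"
    and eq: "\<And>A. A \<in> sets borel \<Longrightarrow> measure F1 A = measure F2 A"
  shows "F1 = F2"
proof (rule measure_eqI)
  interpret F1: real_distribution F1 by fact
  interpret F2: real_distribution F2 by fact
  show "sets F1 = sets F2" by simp
  show "emeasure F1 A = emeasure F2 A" if "A \<in> sets F1" for A
    using that eq[of A] by (simp add: F1.emeasure_eq_measure F2.emeasure_eq_measure)
qed

lemma convolution_return_0:
  assumes "real_distribution F"
  shows "convolution F (return borel 0) = F"
  using conv_power_1[OF assms] by simp

lemma convolution_conv_power:
  assumes G: "real_distribution G"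
  shows "convolution (conv_power G m) (conv_power G n) = conv_power G (m + n)"
proof (induction m)
  case 0
  show ?case
    using convolution_commute_real[OF real_distribution_return real_distribution_conv_power[OF G, of n], of 0]
      convolution_return_0[OF real_distribution_conv_power[OF G, of n]] by simp
next
  case (Suc m)
  then show ?case
    using convolution_assoc_real[OF G real_distribution_conv_power[OF G, of m] real_distribution_conv_power[OF G, of n]]
    by simp
qed

section \<open>Compound Poisson distributions\<close>

text \<open>
  A random sum with a Poisson number of terms: in this form the measure property and the formula for
  integrals are those of the Giry monad.
\<close>

lemma compound_poisson_eq_bind:
  assumes l: "0 < l" and G: "real_distribution G"
  shows "compound_poisson l G = measure_pmf (poisson_pmf l) \<bind> conv_power G"
proof (rule measure_eqI)
  have rd: "real_distribution (conv_power G n)" for n by (rule real_distribution_conv_power[OF G])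
  have N: "conv_power G \<in> measurable (count_space UNIV) (subprob_algebra borel)"
    using rd by (auto simp: space_subprob_algebra real_distribution_def real_distribution_axioms_def
        intro: prob_space_imp_subprob_space)
  have N': "conv_power G \<in> measurable (measure_pmf (poisson_pmf l)) (subprob_algebra borel)"
    using N by simp
  have s: "sets (compound_poisson l G) = sets borel"
    unfolding compound_poisson_def
    by (metis sets.sigma_sets_eq sets_measure_of space_borel sets.space_closed)
  show "sets (compound_poisson l G) = sets (measure_pmf (poisson_pmf l) \<bind> conv_power G)"
    unfolding s by (subst sets_bind[where N = borel]) (use N' in \<open>auto simp: rd[THEN real_distribution.events_eq_borel]\<close>)
  fix A assume "A \<in> sets (compound_poisson l G)"
  then have A: "A \<in> sets borel" using s by simp
  have "emeasure (measure_pmf (poisson_pmf l) \<bind> conv_power G) A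
      = (\<integral>\<^sup>+n. emeasure (conv_power G n) A \<partial>measure_pmf (poisson_pmf l))"
    by (rule emeasure_bind[OF _ N' A]) simp
  also have "\<dots> = (\<Sum>n. ennreal (pmf (poisson_pmf l) n) * emeasure (conv_power G n) A)"
    by (simp add: nn_integral_measure_pmf nn_integral_count_space_nat)
  also have "\<dots> = ennreal (exp (- l)) * (\<Sum>n. ennreal (l ^ n / fact n) * emeasure (conv_power G n) A)"
    unfolding ennreal_suminf_cmult[symmetric]
  proof (intro suminf_cong)
    fix n
    have "ennreal (pmf (poisson_pmf l) n) = ennreal (exp (- l)) * ennreal (l ^ n / fact n)"
      using l by (simp add: ennreal_mult[symmetric] mult.commute)
    then show "ennreal (pmf (poisson_pmf l) n) * emeasure (conv_power G n) A
        = ennreal (exp (- l)) * (ennreal (l ^ n / fact n) * emeasure (conv_power G n) A)"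
      by (simp add: mult.assoc)
  qed
  finally show "emeasure (compound_poisson l G) A = emeasure (measure_pmf (poisson_pmf l) \<bind> conv_power G) A"
    using emeasure_compound_poisson[OF G A] by simp
qed

lemma
  assumes l: "0 < l" and G: "real_distribution G"
  shows real_distribution_compound_poisson: "real_distribution (compound_poisson l G)"
    and integral_compound_poisson:
      "\<And>h :: real \<Rightarrow> real. h \<in> borel_measurable borel \<Longrightarrow> (\<And>x. \<bar>h x\<bar> \<le> K) \<Longrightarrow>
        (\<integral>x. h x \<partial>compound_poisson l G) = exp (- l) * (\<Sum>n. l ^ n / fact n * (\<integral>x. h x \<partial>conv_power G n))"
proof -
  have rd: "real_distribution (conv_power G n)" for n by (rule real_distribution_conv_power[OF G])
  have N: "conv_power G \<in> measurable (measure_pmf (poisson_pmf l)) (subprob_algebra borel)"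
    using rd by (auto simp: space_subprob_algebra real_distribution_def real_distribution_axioms_def
        intro: prob_space_imp_subprob_space)
  have ps: "prob_space (conv_power G n)" for n using rd by (simp add: real_distribution_def)
  have "prob_space (compound_poisson l G)"
    unfolding compound_poisson_eq_bind[OF l G]
    by (rule measure_pmf.prob_space_bind[OF _ N]) (simp add: ps)
  moreover have "sets (compound_poisson l G) = sets borel"
    unfolding compound_poisson_eq_bind[OF l G]
    by (subst sets_bind[where N = borel]) (auto simp: rd[THEN real_distribution.events_eq_borel])
  ultimately show "real_distribution (compound_poisson l G)"
    by (simp add: real_distribution_def real_distribution_axioms_def)
  fix h :: "real \<Rightarrow> real"
  assume h: "h \<in> borel_measurable borel" "\<And>x. \<bar>h x\<bar> \<le> K"
  let ?b = "\<lambda>n. \<integral>x. h x \<partial>conv_power G n"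
  have b: "\<bar>?b n\<bar> \<le> K" for n
    by (rule abs_integral_real_distribution_le[OF rd h])
  have i: "integrable (measure_pmf (poisson_pmf l)) ?b"
    by (rule measure_pmf.integrable_const_bound[of _ K]) (use b in auto)
  have d: "measure_pmf (poisson_pmf l) = density (count_space UNIV) (\<lambda>n. ennreal (pmf (poisson_pmf l) n))"
    by (simp add: measure_pmf_eq_density)
  have "(\<integral>x. h x \<partial>compound_poisson l G) = (\<integral>n. ?b n \<partial>measure_pmf (poisson_pmf l))"
    unfolding compound_poisson_eq_bind[OF l G]
    by (rule integral_bind[OF h(1) h(2) N, where B' = 1])
      (auto simp: measure_pmf.finite_measure prob_space.emeasure_space_1[OF ps])
  also have "\<dots> = (\<integral>n. pmf (poisson_pmf l) n *\<^sub>R ?b n \<partial>count_space UNIV)"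
    unfolding d by (subst integral_density) auto
  also have "\<dots> = (\<Sum>n. pmf (poisson_pmf l) n *\<^sub>R ?b n)"
    using i unfolding d by (subst (asm) integrable_density) (auto intro: integral_count_space_nat)
  also have "\<dots> = (\<Sum>n. exp (- l) * (l ^ n / fact n * ?b n))"
    using l by (simp add: mult_ac)
  also have "\<dots> = exp (- l) * (\<Sum>n. l ^ n / fact n * ?b n)"
    by (rule suminf_mult) (rule summable_norm_cancel[OF bounded_exp_series_summable[OF b]])
  finally show "(\<integral>x. h x \<partial>compound_poisson l G) = exp (- l) * (\<Sum>n. l ^ n / fact n * ?b n)" .
qed

lemma integral_convolution_compound_poisson:
  fixes h :: "real \<Rightarrow> real"
  assumes l: "0 < l" and G: "real_distribution G" and F: "real_distribution F"
    and h [measurable]: "h \<in> borel_measurable borel" and K: "\<And>x. \<bar>h x\<bar> \<le> K"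
  shows "(\<integral>x. h x \<partial>convolution F (compound_poisson l G))
    = exp (- l) * (\<Sum>n. l ^ n / fact n * (\<integral>x. h x \<partial>convolution F (conv_power G n)))"
proof -
  let ?g = "\<lambda>y. \<integral>x. h (y + x) \<partial>F"
  have g: "?g \<in> borel_measurable borel"
    by (rule borel_measurable_integral_translate[OF F F h K])
  have gK: "\<bar>?g y\<bar> \<le> K" for y
    by (rule abs_integral_real_distribution_le[OF F]) (use K in auto)
  have "(\<integral>x. h x \<partial>convolution F (compound_poisson l G)) = (\<integral>y. ?g y \<partial>compound_poisson l G)"
    using integral_convolution_real_swap[OF F real_distribution_compound_poisson[OF l G] h K]
    by (simp add: add.commute)
  also have "\<dots> = exp (- l) * (\<Sum>n. l ^ n / fact n * (\<integral>y. ?g y \<partial>conv_power G n))"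
    by (rule integral_compound_poisson[OF l G g gK])
  also have "\<dots> = exp (- l) * (\<Sum>n. l ^ n / fact n * (\<integral>x. h x \<partial>convolution F (conv_power G n)))"
    using integral_convolution_real_swap[OF F real_distribution_conv_power[OF G] h K]
    by (simp add: add.commute)
  finally show ?thesis .
qed

lemma compound_poisson_convolution:
  assumes s: "0 < s" and t: "0 < t" and G: "real_distribution G"
  shows "convolution (compound_poisson s G) (compound_poisson t G) = compound_poisson (s + t) G"
proof (rule real_distribution_eqI)
  note rs = real_distribution_compound_poisson[OF s G]
  note rt = real_distribution_compound_poisson[OF t G]
  note rp = real_distribution_conv_power[OF G]
  show "real_distribution (convolution (compound_poisson s G) (compound_poisson t G))"
    by (rule real_distribution_convolution[OF rs rt])
  show rst: "real_distribution (compound_poisson (s + t) G)"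
    using s t by (intro real_distribution_compound_poisson G) simp
  fix A :: "real set" assume A: "A \<in> sets borel"
  let ?h = "indicator A :: real \<Rightarrow> real"
  have h: "?h \<in> borel_measurable borel" "\<And>x. \<bar>?h x\<bar> \<le> 1"
    using A by (auto simp: indicator_def)
  let ?b = "\<lambda>n. \<integral>x. ?h x \<partial>conv_power G n"
  have b: "\<bar>?b n\<bar> \<le> 1" for n by (rule abs_integral_real_distribution_le[OF rp h])
  have 1: "(\<integral>x. ?h x \<partial>convolution (compound_poisson s G) (conv_power G n))
      = exp (- s) * (\<Sum>m. s ^ m / fact m * ?b (n + m))" for n
    unfolding convolution_commute_real[OF rs rp]
    using integral_convolution_compound_poisson[OF s G rp h] convolution_conv_power[OF G] by simp
  have b1: "\<bar>\<integral>x. ?h x \<partial>convolution (compound_poisson s G) (conv_power G n)\<bar> \<le> 1" for n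
    by (rule abs_integral_real_distribution_le[OF real_distribution_convolution[OF rs rp] h])
  have e: "(\<lambda>n. t ^ n / fact n * (\<Sum>m. s ^ m / fact m * ?b (n + m))) sums (\<Sum>j. (t + s) ^ j / fact j * ?b j)"
    by (rule exp_series_shift_sums[OF b])
  have "(\<integral>x. ?h x \<partial>convolution (compound_poisson s G) (compound_poisson t G))
      = exp (- t) * (\<Sum>n. t ^ n / fact n * (exp (- s) * (\<Sum>m. s ^ m / fact m * ?b (n + m))))"
    using integral_convolution_compound_poisson[OF t G rs h] unfolding 1 .
  also have "(\<Sum>n. t ^ n / fact n * (exp (- s) * (\<Sum>m. s ^ m / fact m * ?b (n + m))))
      = (\<Sum>n. exp (- s) * (t ^ n / fact n * (\<Sum>m. s ^ m / fact m * ?b (n + m))))"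
    by (simp only: mult.left_commute)
  also have "\<dots> = exp (- s) * (\<Sum>n. t ^ n / fact n * (\<Sum>m. s ^ m / fact m * ?b (n + m)))"
    by (rule suminf_mult[OF sums_summable[OF e]])
  also have "\<dots> = exp (- s) * (\<Sum>j. (s + t) ^ j / fact j * ?b j)"
    unfolding sums_unique[OF e, symmetric] by (simp only: add.commute)
  also have "exp (- t) * \<dots> = exp (- (s + t)) * (\<Sum>j. (s + t) ^ j / fact j * ?b j)"
    unfolding mult.assoc[symmetric] by (simp only: exp_add[symmetric] minus_add_distrib add.commute)
  also have "\<dots> = (\<integral>x. ?h x \<partial>compound_poisson (s + t) G)"
    using s t by (intro integral_compound_poisson[OF _ G h, symmetric]) simp
  finally show "measure (convolution (compound_poisson s G) (compound_poisson t G)) A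
      = measure (compound_poisson (s + t) G) A"
    unfolding measure_eq_integral_indicator[OF real_distribution_convolution[OF rs rt] A]
      measure_eq_integral_indicator[OF rst A] .
qed

lemma measure_compound_poisson:
  assumes l: "0 < l" and G: "real_distribution G" and A: "A \<in> sets borel"
  shows "measure (compound_poisson l G) A = exp (- l) * (\<Sum>n. l ^ n / fact n * measure (conv_power G n) A)"
proof -
  have "(\<integral>x. indicator A x \<partial>compound_poisson l G)
      = exp (- l) * (\<Sum>n. l ^ n / fact n * (\<integral>x. indicator A x \<partial>conv_power G n))"
    by (rule integral_compound_poisson[OF l G, where K = 1]) (use A in \<open>auto simp: indicator_def\<close>)
  then show ?thesis
    using measure_eq_integral_indicator[OF real_distribution_compound_poisson[OF l G] A]
      measure_eq_integral_indicator[OF real_distribution_conv_power[OF G] A] by simp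
qed

lemma measure_compound_poisson_sums:
  assumes l: "0 < l" and G: "real_distribution G" and A: "A \<in> sets borel"
  shows "(\<lambda>n. l ^ n / fact n * measure (conv_power G n) A) sums (exp l * measure (compound_poisson l G) A)"
proof -
  have b: "\<bar>measure (conv_power G n) A\<bar> \<le> 1" for n
    using real_distribution_conv_power[OF G, of n]
    by (simp add: real_distribution_def prob_space.prob_le_1)
  have "exp l * measure (compound_poisson l G) A = (\<Sum>n. l ^ n / fact n * measure (conv_power G n) A)"
    unfolding measure_compound_poisson[OF assms] by (simp add: mult_exp_exp flip: mult.assoc)
  then show ?thesis
    using summable_norm_cancel[OF bounded_exp_series_summable[OF b]] by (simp add: sums_iff)
qed

text \<open>
  Every coefficient of the exponential series increases with the intensity, so a smaller intensity
  costs only the normalising factor. This gives measure-wise domination of a convolution root by the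
  whole distribution.
\<close>

lemma compound_poisson_mono:
  assumes s: "0 < s" "s \<le> t" and G: "real_distribution G" and A: "A \<in> sets borel"
  shows "measure (compound_poisson s G) A \<le> exp (t - s) * measure (compound_poisson t G) A"
proof -
  have t: "0 < t" using s by simp
  have "exp s * measure (compound_poisson s G) A \<le> exp t * measure (compound_poisson t G) A"
    using s
    by (intro sums_le[OF _ measure_compound_poisson_sums[OF s(1) G A] measure_compound_poisson_sums[OF t G A]]
        mult_right_mono divide_right_mono power_mono) auto
  then have "exp (- s) * (exp s * measure (compound_poisson s G) A)
      \<le> exp (- s) * (exp t * measure (compound_poisson t G) A)"
    by simp
  then show ?thesis by (simp add: mult_exp_exp flip: mult.assoc)
qed

text \<open>
  The signed measure \<open>e\<^sup>l exp(-l G)\<close> is the convolution inverse of the compound Poisson distribution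
  \<open>e\<^sup>-\<^sup>l exp(l G)\<close>, so a bounded function is recovered at \<open>0\<close> from its compound Poisson averages by
  an absolutely convergent series.
\<close>

lemma compound_poisson_inversion:
  fixes h :: "real \<Rightarrow> real"
  assumes l: "0 < l" and G: "real_distribution G"
    and h [measurable]: "h \<in> borel_measurable borel" and K: "\<And>x. \<bar>h x\<bar> \<le> K"
  shows "(\<lambda>m. (- l) ^ m / fact m * (\<integral>z. (\<integral>y. h (z + y) \<partial>compound_poisson l G) \<partial>conv_power G m))
    sums (exp (- l) * h 0)"
proof -
  note rp = real_distribution_conv_power[OF G]
  let ?b = "\<lambda>n. \<integral>x. h x \<partial>conv_power G n"
  have b: "\<bar>?b n\<bar> \<le> K" for n by (rule abs_integral_real_distribution_le[OF rp h K])
  have "(\<lambda>m. (- l) ^ m / fact m * (\<Sum>n. l ^ n / fact n * ?b (m + n))) sums (\<Sum>j. (- l + l) ^ j / fact j * ?b j)"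
    by (rule exp_series_shift_sums[OF b])
  also have "(\<Sum>j. (- l + l) ^ j / fact j * ?b j) = ?b 0"
    using powser_zero[of "\<lambda>j. ?b j / fact j"] by (simp add: mult.commute)
  also have "?b 0 = h 0" by (simp add: integral_return)
  finally have s: "(\<lambda>m. (- l) ^ m / fact m * (\<Sum>n. l ^ n / fact n * ?b (m + n))) sums h 0" .
  have "(\<integral>z. (\<integral>y. h (z + y) \<partial>compound_poisson l G) \<partial>conv_power G m)
      = exp (- l) * (\<Sum>n. l ^ n / fact n * ?b (m + n))" for m
    using integral_convolution_real[OF rp real_distribution_compound_poisson[OF l G] h K, of m]
      integral_convolution_compound_poisson[OF l G rp h K, of m] convolution_conv_power[OF G]
    by simp
  then show ?thesis
    using sums_mult[OF s, of "exp (- l)"] by (simp add: mult_ac)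
qed

section \<open>Splitting the local mass of a convolution\<close>

lemma local_mass_eq_cdf_diff:
  assumes "real_distribution F" "0 < c"
  shows "local_mass F c x = cdf F (x + c) - cdf F x"
proof -
  interpret real_distribution F by fact
  show ?thesis unfolding local_mass_def using assms(2) by (subst cdf_diff_eq) auto
qed

lemma borel_measurable_local_mass:
  assumes "real_distribution F" "0 < c"
  shows "local_mass F c \<in> borel_measurable borel"
proof -
  interpret real_distribution F by fact
  have [measurable]: "cdf F \<in> borel_measurable borel"
    by (intro borel_measurable_mono monoI cdf_nondecreasing)
  have "local_mass F c = (\<lambda>x. cdf F (x + c) - cdf F x)"
    by (intro ext local_mass_eq_cdf_diff assms)
  then show ?thesis by simp
qed

lemma local_mass_nonneg: "0 \<le> local_mass F c x"
  by (simp add: local_mass_def)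

lemma local_mass_le_1:
  assumes "real_distribution F"
  shows "local_mass F c x \<le> 1"
  using assms unfolding local_mass_def real_distribution_def by (simp add: prob_space.prob_le_1)

text \<open>
  In terms of independent \<open>X\<close> with law \<open>F\<close> and \<open>Y\<close> with law \<open>N\<close>, the following two quantities are the
  probabilities of \<open>X + Y \<in> x + \<Delta>\<close> together with \<open>Y \<le> B\<close>, and together with \<open>X > B\<close> and \<open>Y > B\<close>.
\<close>

definition left_part :: "real \<Rightarrow> real measure \<Rightarrow> real measure \<Rightarrow> real \<Rightarrow> real \<Rightarrow> real" where
  "left_part c F N B x = (\<integral>y. indicator {..B} y * local_mass F c (x - y) \<partial>N)"

definition joint_tail :: "real \<Rightarrow> real measure \<Rightarrow> real measure \<Rightarrow> real \<Rightarrow> real \<Rightarrow> real" where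
  "joint_tail c F N B x = measure (F \<Otimes>\<^sub>M N)
    {z. B < fst z \<and> B < snd z \<and> x < fst z + snd z \<and> fst z + snd z \<le> x + c}"

lemma sets_pair_borelI:
  fixes P :: "real \<times> real \<Rightarrow> bool"
  assumes "Measurable.pred (borel \<Otimes>\<^sub>M borel) P"
  shows "{z. P z} \<in> sets (borel \<Otimes>\<^sub>M borel)"
  using assms by (simp add: pred_def space_pair_measure)

lemma sets_pair_real_distribution:
  assumes "real_distribution F" "real_distribution N"
  shows "sets (F \<Otimes>\<^sub>M N) = sets (borel \<Otimes>\<^sub>M borel)"
  using assms by (intro sets_pair_measure_cong) (auto simp: real_distribution.events_eq_borel)

lemma
  assumes F: "real_distribution F" and N: "real_distribution N" and c: "0 < c"
    and A [measurable]: "A \<in> sets borel"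
  shows measure_pair_snd_slice:
      "measure (F \<Otimes>\<^sub>M N) {z. snd z \<in> A \<and> x < fst z + snd z \<and> fst z + snd z \<le> x + c}
        = (\<integral>y. indicator A y * local_mass F c (x - y) \<partial>N)"
    and integrable_indicator_local_mass:
      "integrable N (\<lambda>y. indicator A y * local_mass F c (x - y))"
proof -
  interpret F: real_distribution F by fact
  interpret N: real_distribution N by fact
  interpret P: pair_prob_space F N ..
  note [measurable] = borel_measurable_local_mass[OF F c]
  let ?E = "{z. snd z \<in> A \<and> x < fst z + snd z \<and> fst z + snd z \<le> x + c}"
  have E: "?E \<in> sets (F \<Otimes>\<^sub>M N)"
    unfolding sets_pair_real_distribution[OF F N] by (rule sets_pair_borelI) measurable
  show i: "integrable N (\<lambda>y. indicator A y * local_mass F c (x - y))"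
    by (rule N.integrable_const_bound[of _ 1])
      (auto simp: local_mass_nonneg local_mass_le_1[OF F] abs_mult split: split_indicator)
  have "emeasure (F \<Otimes>\<^sub>M N) ?E = (\<integral>\<^sup>+y. emeasure F ((\<lambda>u. (u, y)) -` ?E) \<partial>N)"
    by (rule P.emeasure_pair_measure_alt2[OF E])
  also have "\<dots> = (\<integral>\<^sup>+y. ennreal (indicator A y * local_mass F c (x - y)) \<partial>N)"
  proof (rule nn_integral_cong)
    fix y
    have "(\<lambda>u. (u, y)) -` ?E = (if y \<in> A then {x - y<..x - y + c} else {})"
      by (auto simp: algebra_simps)
    then show "emeasure F ((\<lambda>u. (u, y)) -` ?E) = ennreal (indicator A y * local_mass F c (x - y))"
      by (simp add: F.emeasure_eq_measure local_mass_def)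
  qed
  also have "\<dots> = ennreal (\<integral>y. indicator A y * local_mass F c (x - y) \<partial>N)"
    by (rule nn_integral_eq_integral[OF i]) (auto simp: local_mass_nonneg)
  finally show "measure (F \<Otimes>\<^sub>M N) ?E = (\<integral>y. indicator A y * local_mass F c (x - y) \<partial>N)"
    by (simp add: measure_def integral_nonneg_AE local_mass_nonneg)
qed

lemma measure_pair_swap:
  assumes F: "real_distribution F" and N: "real_distribution N"
    and E: "{z. Q (fst z) (snd z)} \<in> sets (borel \<Otimes>\<^sub>M borel)"
  shows "measure (F \<Otimes>\<^sub>M N) {z. Q (fst z) (snd z)} = measure (N \<Otimes>\<^sub>M F) {z. Q (snd z) (fst z)}"
proof -
  interpret F: real_distribution F by fact
  interpret N: real_distribution N by fact
  interpret P: pair_prob_space F N ..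
  note s = sets_pair_real_distribution[OF F N]
  have "measure (F \<Otimes>\<^sub>M N) {z. Q (fst z) (snd z)}
      = measure (distr (N \<Otimes>\<^sub>M F) (F \<Otimes>\<^sub>M N) (\<lambda>(x, y). (y, x))) {z. Q (fst z) (snd z)}"
    using P.distr_pair_swap by simp
  also have "\<dots> = measure (N \<Otimes>\<^sub>M F) ((\<lambda>(x, y). (y, x)) -` {z. Q (fst z) (snd z)} \<inter> space (N \<Otimes>\<^sub>M F))"
    by (rule measure_distr) (use E s in auto)
  also have "(\<lambda>(x, y). (y, x)) -` {z. Q (fst z) (snd z)} \<inter> space (N \<Otimes>\<^sub>M F) = {z. Q (snd z) (fst z)}"
    by (auto simp: space_pair_measure)
  finally show ?thesis .
qed

lemma measure_pair_fst_slice: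
  assumes F: "real_distribution F" and N: "real_distribution N" and c: "0 < c"
    and A [measurable]: "A \<in> sets borel"
  shows "measure (F \<Otimes>\<^sub>M N) {z. fst z \<in> A \<and> x < fst z + snd z \<and> fst z + snd z \<le> x + c}
    = (\<integral>y. indicator A y * local_mass N c (x - y) \<partial>F)"
proof -
  have "measure (F \<Otimes>\<^sub>M N) {z. fst z \<in> A \<and> x < fst z + snd z \<and> fst z + snd z \<le> x + c}
      = measure (N \<Otimes>\<^sub>M F) {z. snd z \<in> A \<and> x < snd z + fst z \<and> snd z + fst z \<le> x + c}"
    by (rule measure_pair_swap[OF F N], rule sets_pair_borelI) measurable
  then show ?thesis
    using measure_pair_snd_slice[OF N F c A, of x] by (simp add: add.commute)
qed

lemma joint_tail_commute:
  assumes "real_distribution F" "real_distribution N"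
  shows "joint_tail c F N B x = joint_tail c N F B x"
proof -
  have "joint_tail c F N B x = measure (N \<Otimes>\<^sub>M F)
      {z. B < snd z \<and> B < fst z \<and> x < snd z + fst z \<and> snd z + fst z \<le> x + c}"
    unfolding joint_tail_def by (rule measure_pair_swap[OF assms], rule sets_pair_borelI) measurable
  then show ?thesis by (simp add: joint_tail_def add.commute conj_ac)
qed

lemma local_mass_convolution:
  assumes F: "real_distribution F" and N: "real_distribution N"
  shows "local_mass (convolution F N) c x
    = measure (F \<Otimes>\<^sub>M N) {z. x < fst z + snd z \<and> fst z + snd z \<le> x + c}"
proof -
  interpret F: real_distribution F by fact
  interpret N: real_distribution N by fact
  have "(\<lambda>(x, y). x + y) -` {x<..x + c} \<inter> space (F \<Otimes>\<^sub>M N) = {z. x < fst z + snd z \<and> fst z + snd z \<le> x + c}"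
    by (auto simp: space_pair_measure)
  then show ?thesis
    unfolding local_mass_def convolution_def by (subst measure_distr) auto
qed

text \<open>
  For \<open>x \<ge> 2B\<close> the two summands cannot both be at most \<open>B\<close>, which makes the three events disjoint.
\<close>

lemma local_mass_convolution_decomp:
  assumes F: "real_distribution F" and N: "real_distribution N" and c: "0 < c" and x: "2 * B \<le> x"
  shows "local_mass (convolution F N) c x
    = left_part c F N B x + left_part c N F B x + joint_tail c F N B x"
proof -
  interpret F: real_distribution F by fact
  interpret N: real_distribution N by fact
  interpret P: pair_prob_space F N ..
  let ?E = "\<lambda>Q. {z. Q (fst z) (snd z) \<and> x < fst z + snd z \<and> fst z + snd z \<le> x + c}"
  let ?E1 = "?E (\<lambda>u v. v \<in> {..B})" and ?E2 = "?E (\<lambda>u v. u \<in> {..B})"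
    and ?E3 = "{z. B < fst z \<and> B < snd z \<and> x < fst z + snd z \<and> fst z + snd z \<le> x + c}"
  have m: "?E1 \<in> sets (F \<Otimes>\<^sub>M N)" "?E2 \<in> sets (F \<Otimes>\<^sub>M N)" "?E3 \<in> sets (F \<Otimes>\<^sub>M N)"
    unfolding sets_pair_real_distribution[OF F N] by (rule sets_pair_borelI, measurable)+
  have "{z. x < fst z + snd z \<and> fst z + snd z \<le> x + c} = (?E1 \<union> ?E2) \<union> ?E3"
    by auto
  then have "local_mass (convolution F N) c x = measure (F \<Otimes>\<^sub>M N) ((?E1 \<union> ?E2) \<union> ?E3)"
    by (simp add: local_mass_convolution[OF F N])
  also have "\<dots> = measure (F \<Otimes>\<^sub>M N) (?E1 \<union> ?E2) + measure (F \<Otimes>\<^sub>M N) ?E3"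
    by (rule P.finite_measure_Union) (use m in auto)
  also have "measure (F \<Otimes>\<^sub>M N) (?E1 \<union> ?E2) = measure (F \<Otimes>\<^sub>M N) ?E1 + measure (F \<Otimes>\<^sub>M N) ?E2"
    by (rule P.finite_measure_Union) (use m x in auto)
  finally show ?thesis
    using measure_pair_snd_slice[OF F N c, of "{..B}" x] measure_pair_fst_slice[OF F N c, of "{..B}" x]
    by (simp add: left_part_def joint_tail_def)
qed

text \<open>
  On the joint tail the second summand is less than \<open>x + c - B\<close>, so only local masses of \<open>F\<close> to the right
  of \<open>B - c\<close> enter, where \<open>F\<close> is dominated by \<open>M\<close>. The loss of \<open>c\<close> in the cut-off is the length of the
  interval.
\<close>

lemma joint_tail_dominated:
  assumes F: "real_distribution F" and N: "real_distribution N" and M: "real_distribution M"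
    and c: "0 < c" and dom: "\<And>u. u0 \<le> u \<Longrightarrow> local_mass F c u \<le> C * local_mass M c u"
    and C: "0 \<le> C" and B: "u0 \<le> B - c"
  shows "joint_tail c F N B x \<le> C * joint_tail c M N (B - c) x"
proof -
  interpret F: real_distribution F by fact
  interpret N: real_distribution N by fact
  interpret M: real_distribution M by fact
  interpret P: pair_prob_space F N ..
  interpret Q: pair_prob_space M N ..
  let ?A = "{B<..<x + c - B}"
  let ?E = "{z. snd z \<in> ?A \<and> x < fst z + snd z \<and> fst z + snd z \<le> x + c}"
  have "joint_tail c F N B x \<le> measure (F \<Otimes>\<^sub>M N) ?E"
    unfolding joint_tail_def
  proof (rule P.finite_measure_mono)
    show "?E \<in> P.events"
      unfolding sets_pair_real_distribution[OF F N] by (rule sets_pair_borelI) measurable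
  qed auto
  also have "\<dots> = (\<integral>y. indicator ?A y * local_mass F c (x - y) \<partial>N)"
    by (rule measure_pair_snd_slice[OF F N c]) simp
  also have "\<dots> \<le> (\<integral>y. C * (indicator ?A y * local_mass M c (x - y)) \<partial>N)"
  proof (rule integral_mono)
    show "indicator ?A y * local_mass F c (x - y) \<le> C * (indicator ?A y * local_mass M c (x - y))" for y
      using dom[of "x - y"] B by (auto split: split_indicator)
  qed (auto intro!: integrable_indicator_local_mass F N M c)
  also have "\<dots> = C * measure (M \<Otimes>\<^sub>M N) ?E"
    using measure_pair_snd_slice[OF M N c, of ?A x] by simp
  also have "\<dots> \<le> C * joint_tail c M N (B - c) x"
    unfolding joint_tail_def
  proof (intro mult_left_mono Q.finite_measure_mono C)
    show "{z. B - c < fst z \<and> B - c < snd z \<and> x < fst z + snd z \<and> fst z + snd z \<le> x + c} \<in> Q.events"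
      unfolding sets_pair_real_distribution[OF M N] by (rule sets_pair_borelI) measurable
  qed (use c in auto)
  finally show ?thesis .
qed

lemma measure_atMost_tendsto_1:
  assumes "real_distribution F"
  shows "((\<lambda>B. measure F {..B}) \<longlongrightarrow> 1) at_top"
proof -
  interpret real_distribution F by fact
  show ?thesis using cdf_lim_at_top_prob by (simp add: cdf_def)
qed

section \<open>Distributions carried by the line or the half-line\<close>

text \<open>
  The set \<open>S\<close> will be the line or the half-line; both contain \<open>0\<close> and are closed under addition, which
  is what makes the property stable under convolution powers and mixtures.
\<close>

definition carried :: "real set \<Rightarrow> real measure \<Rightarrow> bool" where
  "carried S F \<longleftrightarrow> real_distribution F \<and> (AE y in F. y \<in> S)"

lemma carried_UNIV: "carried UNIV F \<longleftrightarrow> real_distribution F"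
  by (simp add: carried_def)

lemma carried_nonneg_iff:
  "carried {0..} F \<longleftrightarrow> real_distribution F \<and> measure F {0..} = 1"
proof (cases "real_distribution F")
  case True
  then interpret real_distribution F .
  show ?thesis using True by (simp add: carried_def prob_eq_1)
qed (simp add: carried_def)

lemma carried_convolution:
  assumes S: "S = UNIV \<or> S = {0..}" and F: "carried S F" and N: "carried S N"
  shows "carried S (convolution F N)"
proof -
  have rF: "real_distribution F" and rN: "real_distribution N"
    using F N by (auto simp: carried_def)
  have rc: "real_distribution (convolution F N)"
    by (rule real_distribution_convolution[OF rF rN])
  interpret F: real_distribution F by fact
  interpret N: real_distribution N by fact
  show ?thesis using S
  proof
    assume S0: "S = {0..}"
    let ?h = "indicator {0..} :: real \<Rightarrow> real"
    have "(\<integral>x. ?h x \<partial>convolution F N) = (\<integral>x. (\<integral>y. ?h (x + y) \<partial>N) \<partial>F)"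
      by (rule integral_convolution_real[OF rF rN, where K = 1]) (auto simp: indicator_def)
    also have "\<dots> = (\<integral>x. 1 \<partial>F)"
    proof (rule integral_cong_AE)
      show "AE x in F. (\<integral>y. ?h (x + y) \<partial>N) = 1"
      proof -
        have "AE x in F. x \<in> {0..}" using F unfolding carried_def S0 by simp
        then show ?thesis
        proof eventually_elim
          fix x :: real assume x: "x \<in> {0..}"
          have "(\<integral>y. ?h (x + y) \<partial>N) = (\<integral>y. 1 \<partial>N)"
            using N x unfolding carried_def S0
            by (intro integral_cong_AE) (auto elim!: eventually_mono)
          then show "(\<integral>y. ?h (x + y) \<partial>N) = 1" using N.prob_space by simp
        qed
      qed
      show "(\<lambda>x. \<integral>y. ?h (x + y) \<partial>N) \<in> borel_measurable F"
        using borel_measurable_integral_translate[OF rF rN, of ?h 1] by (auto simp: indicator_def)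
    qed simp
    also have "\<dots> = 1" using F.prob_space by simp
    finally have "measure (convolution F N) {0..} = 1"
      by (subst measure_eq_integral_indicator[OF rc]) auto
    then show ?thesis using rc unfolding S0 carried_nonneg_iff by blast
  qed (use rc in \<open>simp add: carried_UNIV\<close>)
qed

lemma carried_conv_power:
  assumes S: "S = UNIV \<or> S = {0..}" and G: "carried S G"
  shows "carried S (conv_power G n)"
proof (induction n)
  case 0
  have "AE y in return borel (0::real). y \<in> S"
    using S by (subst AE_return) auto
  then show ?case by (simp add: carried_def real_distribution_return)
next
  case (Suc n)
  then show ?case using carried_convolution[OF S G] by simp
qed

lemma carried_compound_poisson:
  assumes S: "S = UNIV \<or> S = {0..}" and l: "0 < l" and G: "carried S G"
  shows "carried S (compound_poisson l G)"
proof -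
  have rG: "real_distribution G" using G by (simp add: carried_def)
  have r: "real_distribution (compound_poisson l G)"
    by (rule real_distribution_compound_poisson[OF l rG])
  have "measure (compound_poisson l G) {0..} = 1" if S0: "S = {0..}"
  proof -
    have "measure (conv_power G n) {0..} = 1" for n
      using carried_conv_power[OF S G, of n] unfolding S0 carried_nonneg_iff by simp
    then have "measure (compound_poisson l G) {0..} = exp (- l) * (\<Sum>n. l ^ n / fact n)"
      using measure_compound_poisson[OF l rG, of "{0..}"] by simp
    also have "(\<Sum>n. l ^ n / fact n) = exp l"
      by (rule sums_unique[OF exp_sums_divide, symmetric])
    finally show ?thesis by (simp add: mult_exp_exp)
  qed
  then show ?thesis using S r by (auto simp: carried_UNIV carried_nonneg_iff)
qed

section \<open>Long-tailed local masses\<close>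

text \<open>
  The two alternatives for \<open>S\<close> are the two-sided case, in which almost decrease is required, and the
  half-line. The distribution \<open>M\<close> is the reference against which other local masses are measured.
\<close>

locale long_tailed_local =
  fixes c :: real and S :: "real set" and M :: "real measure"
  assumes c: "0 < c" and M: "M \<in> L_Delta c"
    and S: "S = UNIV \<and> almost_decreasing (local_mass M c) \<or> S = {0..}"
begin

abbreviation \<alpha> :: "real \<Rightarrow> real" where "\<alpha> \<equiv> local_mass M c"

definition ratio :: "real measure \<Rightarrow> real \<Rightarrow> real" where
  "ratio F x = local_mass F c x / \<alpha> x"

lemma S_cases: "S = UNIV \<or> S = {0..}" using S by auto

lemma real_distribution_M: "real_distribution M" using M by (simp add: L_Delta_def)

lemma eventually_pos: "eventually (\<lambda>x. 0 < \<alpha> x) at_top"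
  using M unfolding L_Delta_def L_fun_def eventually_at_top_linorder by auto

lemma shift_ratio_tendsto: "((\<lambda>x. \<alpha> (x - y) / \<alpha> x) \<longlongrightarrow> 1) at_top"
proof -
  have pos: "((\<lambda>x. \<alpha> (x + y) / \<alpha> x) \<longlongrightarrow> 1) at_top" if "0 < y" for y
  proof (rule asymp_equivD_strong)
    show "(\<lambda>x. \<alpha> (x + y)) \<sim>[at_top] \<alpha>" using M that by (auto simp: L_Delta_def L_fun_def)
    show "\<forall>\<^sub>F x in at_top. \<alpha> (x + y) \<noteq> 0 \<or> \<alpha> x \<noteq> 0"
      using eventually_pos by (rule eventually_mono) auto
  qed
  consider "0 < y" | "y = 0" | "y < 0" by linarith
  then show ?thesis
  proof cases
    case 1
    have "filterlim (\<lambda>x. x - y) at_top at_top"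
      using filterlim_tendsto_add_at_top[OF tendsto_const[of "- y"] filterlim_ident] by simp
    from filterlim_compose[OF pos[OF 1] this]
    have "((\<lambda>x. inverse (\<alpha> x / \<alpha> (x - y))) \<longlongrightarrow> inverse 1) at_top"
      by (intro tendsto_inverse) auto
    then show ?thesis by simp
  next
    case 2
    have "\<forall>\<^sub>F x in at_top. 1 = \<alpha> (x - y) / \<alpha> x"
      using eventually_pos by (rule eventually_mono) (simp add: 2)
    then show ?thesis by (rule Lim_transform_eventually[OF tendsto_const])
  next
    case 3
    then show ?thesis using pos[of "- y"] by simp
  qed
qed

text \<open>
  Local masses at points within a bounded distance are comparable, uniformly on a half-line: if
  \<open>\<bar>x - z\<bar> \<le> c\<close>, then \<open>z + \<Delta>\<close> is covered by \<open>x + \<Delta>\<close> and one of its two neighbours of length \<open>c\<close>, and a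
  bounded distance is a bounded number of such steps. This covering argument stands in for the uniform convergence theorem
  for long-tailed functions.
\<close>

lemma comparable:
  obtains X where "0 \<le> X" "\<And>x. X \<le> x \<Longrightarrow> 0 < \<alpha> x"
    "\<And>T. \<exists>C\<ge>0. \<forall>x\<ge>X. \<forall>z\<ge>X. \<bar>x - z\<bar> \<le> T \<longrightarrow> \<alpha> z \<le> C * \<alpha> x"
proof -
  interpret M: real_distribution M by (rule real_distribution_M)
  (* Any bound above 1 would do: the neighbouring masses are asymptotically equal. *)
  have "\<forall>\<^sub>F x in at_top. \<alpha> (x - c) / \<alpha> x < 2 \<and> \<alpha> (x - (- c)) / \<alpha> x < 2 \<and> 0 < \<alpha> x"
    by (intro eventually_conj order_tendstoD(2)[OF shift_ratio_tendsto] eventually_pos) auto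
  then obtain X0 where X0: "\<And>x. X0 \<le> x \<Longrightarrow> \<alpha> (x - c) / \<alpha> x < 2 \<and> \<alpha> (x + c) / \<alpha> x < 2 \<and> 0 < \<alpha> x"
    by (auto simp: eventually_at_top_linorder)
  define X where "X = max 0 X0"
  have step: "\<alpha> (x - c) \<le> 2 * \<alpha> x" "\<alpha> (x + c) \<le> 2 * \<alpha> x" "0 < \<alpha> x" if "X \<le> x" for x
    using X0[of x] that by (auto simp: X_def divide_less_eq)
  have union: "\<alpha> z \<le> \<alpha> x + \<alpha> (x + c)" if "x \<le> z" "z \<le> x + c" for x z
  proof -
    have "\<alpha> z \<le> measure M ({x<..x + c} \<union> {x + c<..x + c + c})"
      unfolding local_mass_def using that c by (intro M.finite_measure_mono) auto
    also have "\<dots> \<le> \<alpha> x + \<alpha> (x + c)"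
      unfolding local_mass_def by (rule measure_Un_le) auto
    finally show ?thesis .
  qed
  have near: "\<alpha> z \<le> 3 * \<alpha> x" if "X \<le> x" "\<bar>x - z\<bar> \<le> c" for x z
  proof (cases "x \<le> z")
    case True
    then show ?thesis using union[of x z] step[of x] that by auto
  next
    case False
    then show ?thesis using union[of "x - c" z] step[of x] that by auto
  qed
  have far: "\<alpha> z \<le> 3 ^ n * \<alpha> x" if "X \<le> x" "X \<le> z" "\<bar>x - z\<bar> \<le> real n * c" for x z n
    using that
  proof (induction n arbitrary: z)
    case 0
    then show ?case by simp
  next
    case (Suc n)
    (* w is one step of length c from z towards x. *)
    define w where "w = (if \<bar>x - z\<bar> \<le> c then x else if x \<le> z then z - c else z + c)"
    have w: "X \<le> w" "\<bar>w - z\<bar> \<le> c" "\<bar>x - w\<bar> \<le> real n * c"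
      using Suc.prems c by (auto simp: w_def algebra_simps abs_if split: if_splits)
    have "\<alpha> z \<le> 3 * \<alpha> w" by (rule near[OF w(1,2)])
    also have "\<dots> \<le> 3 * (3 ^ n * \<alpha> x)" using Suc.IH[OF Suc.prems(1) w(1,3)] by simp
    finally show ?case by simp
  qed
  show thesis
  proof (rule that)
    show "0 \<le> X" by (simp add: X_def)
    show "\<And>x. X \<le> x \<Longrightarrow> 0 < \<alpha> x" by (rule step)
    fix T
    obtain n where n: "T / c \<le> real n" using real_arch_simple by blast
    then have "T \<le> real n * c" using c by (simp add: divide_le_eq)
    then have "\<forall>x\<ge>X. \<forall>z\<ge>X. \<bar>x - z\<bar> \<le> T \<longrightarrow> \<alpha> z \<le> 3 ^ n * \<alpha> x"
      using far[of _ _ n] by auto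
    then show "\<exists>C\<ge>0. \<forall>x\<ge>X. \<forall>z\<ge>X. \<bar>x - z\<bar> \<le> T \<longrightarrow> \<alpha> z \<le> C * \<alpha> x"
      by (intro exI[of _ "3 ^ n"]) auto
  qed
qed

text \<open>
  The bound that justifies every use of dominated convergence below. The threshold \<open>X\<close> must not depend on
  \<open>B\<close>: in \<open>conv_power_geometric_bound\<close> it is chosen before \<open>B\<close>. That is why \<open>x - y\<close> may fall to
  the left of \<open>X\<close>; then \<open>x\<close> stays within a bounded distance of \<open>X\<close>, where \<open>\<alpha>\<close> is bounded away from \<open>0\<close>,
  and the trivial bound \<open>1\<close> for a probability suffices.
\<close>

lemma left_bound:
  obtains X where "0 \<le> X" "\<And>x. X \<le> x \<Longrightarrow> 0 < \<alpha> x"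
    "\<And>B. \<exists>C\<ge>1. \<forall>x\<ge>X. \<forall>y\<in>S. y \<le> B \<longrightarrow> \<alpha> (x - y) \<le> C * \<alpha> x"
proof -
  obtain X1 where X1: "0 \<le> X1" "\<And>x. X1 \<le> x \<Longrightarrow> 0 < \<alpha> x"
    "\<And>T. \<exists>C\<ge>0. \<forall>x\<ge>X1. \<forall>z\<ge>X1. \<bar>x - z\<bar> \<le> T \<longrightarrow> \<alpha> z \<le> C * \<alpha> x"
    using comparable by blast
  obtain X2 K where XK: "0 \<le> K" "\<And>x y. X2 \<le> x \<Longrightarrow> y \<in> S \<Longrightarrow> y < 0 \<Longrightarrow> \<alpha> (x - y) \<le> K * \<alpha> x"
  proof (cases "S = {0..}")
    case True
    then show ?thesis using that[of 0 0] by auto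
  next
    case False
    then obtain x0 K where K: "0 < K" "\<And>x y. x0 < x \<Longrightarrow> 0 < y \<Longrightarrow> \<alpha> (x + y) \<le> K * \<alpha> x"
      using S unfolding almost_decreasing_def by blast
    show ?thesis
      by (rule that[of K "x0 + 1"]) (use K(1) K(2)[of _ "- _"] in auto)
  qed
  define X where "X = max X1 X2"
  show thesis
  proof (rule that)
    show "0 \<le> X" "\<And>x. X \<le> x \<Longrightarrow> 0 < \<alpha> x" using X1 by (auto simp: X_def)
    fix B :: real
    obtain C1 where C1: "0 \<le> C1"
      "\<And>x z. X1 \<le> x \<Longrightarrow> X1 \<le> z \<Longrightarrow> \<bar>x - z\<bar> \<le> max 0 B \<Longrightarrow> \<alpha> z \<le> C1 * \<alpha> x"
      using X1(3)[of "max 0 B"] by blast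
    have p: "0 < \<alpha> X1" using X1(2) by simp
    let ?C = "1 + K + C1 + C1 / \<alpha> X1"
    have "\<alpha> (x - y) \<le> ?C * \<alpha> x" if x: "X \<le> x" and y: "y \<in> S" "y \<le> B" for x y
    proof -
      have ax: "0 < \<alpha> x" using X1(2)[of x] x by (simp add: X_def)
      have pos: "0 \<le> K * \<alpha> x" "0 \<le> C1 * \<alpha> x" "0 \<le> C1 / \<alpha> X1 * \<alpha> x" using ax p XK(1) C1(1) by auto
      have e: "?C * \<alpha> x = \<alpha> x + K * \<alpha> x + C1 * \<alpha> x + C1 / \<alpha> X1 * \<alpha> x" by (simp add: algebra_simps)
      consider "y < 0" | "0 \<le> y" "X1 \<le> x - y" | "0 \<le> y" "x - y < X1" by linarith
      then show ?thesis
      proof cases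
        case 1
        then show ?thesis using XK(2)[of x y] x y ax pos unfolding e by (auto simp: X_def)
      next
        case 2
        then show ?thesis using C1(2)[of x "x - y"] x y ax pos unfolding e by (auto simp: X_def)
      next
        case 3
        then have "\<alpha> X1 \<le> C1 * \<alpha> x" using C1(2)[of x X1] x y by (auto simp: X_def)
        then have "1 \<le> C1 / \<alpha> X1 * \<alpha> x" using p by (simp add: field_simps)
        then show ?thesis using local_mass_le_1[OF real_distribution_M, of c "x - y"] ax pos unfolding e by linarith
      qed
    qed
    then show "\<exists>C\<ge>1. \<forall>x\<ge>X. \<forall>y\<in>S. y \<le> B \<longrightarrow> \<alpha> (x - y) \<le> C * \<alpha> x"
      using XK(1) C1(1) p by (intro exI[of _ ?C]) auto
  qed
qed

lemma ratio_compound_poisson_sums: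
  assumes l: "0 < l"
  shows "(\<lambda>n. l ^ n / fact n * ratio (conv_power M n) x) sums (exp l * ratio (compound_poisson l M) x)"
  using sums_divide[OF measure_compound_poisson_sums[OF l real_distribution_M greaterThanAtMost_borel], of x "x + c" "\<alpha> x"]
  unfolding ratio_def local_mass_def by (simp only: times_divide_eq_right)

lemma ratio_self_tendsto: "(ratio M \<longlongrightarrow> 1) at_top"
  using shift_ratio_tendsto[of 0] by (simp add: ratio_def[abs_def])

lemma ratio_shift_tendsto:
  assumes "(ratio F \<longlongrightarrow> a) at_top"
  shows "((\<lambda>x. local_mass F c (x - y) / \<alpha> x) \<longlongrightarrow> a) at_top"
proof -
  have f: "filterlim (\<lambda>x. x - y) at_top at_top"
    using filterlim_tendsto_add_at_top[OF tendsto_const[of "- y"] filterlim_ident] by simp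
  have "((\<lambda>x. ratio F (x - y) * (\<alpha> (x - y) / \<alpha> x)) \<longlongrightarrow> a * 1) at_top"
    by (intro tendsto_mult filterlim_compose[OF assms f] shift_ratio_tendsto)
  moreover have "\<forall>\<^sub>F x in at_top. ratio F (x - y) * (\<alpha> (x - y) / \<alpha> x) = local_mass F c (x - y) / \<alpha> x"
    using eventually_compose_filterlim[OF eventually_pos f]
    by (rule eventually_mono) (simp add: ratio_def)
  ultimately show ?thesis by (simp add: Lim_transform_eventually)
qed

lemma ratio_nonneg: "0 \<le> ratio F x"
  by (simp add: ratio_def local_mass_nonneg)

lemma eventually_le_of_ratio:
  assumes "(ratio F \<longlongrightarrow> a) at_top" "a < b"
  shows "\<exists>u0. \<forall>u\<ge>u0. local_mass F c u \<le> b * \<alpha> u"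
proof -
  have "\<forall>\<^sub>F x in at_top. local_mass F c x \<le> b * \<alpha> x"
    using order_tendstoD(2)[OF assms] eventually_pos
    by eventually_elim (simp add: ratio_def divide_less_eq)
  then show ?thesis by (simp add: eventually_at_top_linorder)
qed

lemma left_part_bound:
  assumes F: "\<And>u. u0 \<le> u \<Longrightarrow> local_mass F c u \<le> C' * \<alpha> u" and C': "0 \<le> C'"
  shows "\<exists>K\<ge>0. \<forall>\<^sub>F x in at_top. \<forall>y\<in>S. y \<le> B \<longrightarrow> local_mass F c (x - y) / \<alpha> x \<le> K"
proof -
  obtain X where X: "0 \<le> X" "\<And>x. X \<le> x \<Longrightarrow> 0 < \<alpha> x"
    "\<And>B. \<exists>C\<ge>1. \<forall>x\<ge>X. \<forall>y\<in>S. y \<le> B \<longrightarrow> \<alpha> (x - y) \<le> C * \<alpha> x"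
    using left_bound by blast
  obtain C where C: "1 \<le> C" "\<And>x y. X \<le> x \<Longrightarrow> y \<in> S \<Longrightarrow> y \<le> B \<Longrightarrow> \<alpha> (x - y) \<le> C * \<alpha> x"
    using X(3)[of B] by blast
  have "\<forall>\<^sub>F x in at_top. \<forall>y\<in>S. y \<le> B \<longrightarrow> local_mass F c (x - y) / \<alpha> x \<le> C' * C"
    using eventually_ge_at_top[of "max X (u0 + B)"]
  proof (rule eventually_mono, intro ballI impI)
    fix x y assume x: "max X (u0 + B) \<le> x" and y: "y \<in> S" "y \<le> B"
    have "local_mass F c (x - y) \<le> C' * \<alpha> (x - y)" using F[of "x - y"] x y by simp
    also have "\<dots> \<le> C' * (C * \<alpha> x)" using C(2)[of x y] x y C' by (intro mult_left_mono) auto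
    finally show "local_mass F c (x - y) / \<alpha> x \<le> C' * C"
      using X(2)[of x] x by (simp add: divide_le_eq mult.assoc)
  qed
  then show ?thesis using C(1) C' by (intro exI[of _ "C' * C"]) auto
qed

lemma left_part_ratio_tendsto:
  assumes F: "real_distribution F" and a: "(ratio F \<longlongrightarrow> a) at_top" and N: "carried S N"
  shows "((\<lambda>x. left_part c F N B x / \<alpha> x) \<longlongrightarrow> a * measure N {..B}) at_top"
proof -
  interpret N: real_distribution N using N by (simp add: carried_def)
  note [measurable] = borel_measurable_local_mass[OF F c]
  have a0: "0 \<le> a" using tendsto_lowerbound[OF a] by (simp add: ratio_nonneg)
  obtain u0 where u0: "\<And>u. u0 \<le> u \<Longrightarrow> local_mass F c u \<le> (a + 1) * \<alpha> u"
    using eventually_le_of_ratio[OF a, of "a + 1"] by auto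
  obtain K where K: "0 \<le> K"
    "\<forall>\<^sub>F x in at_top. \<forall>y\<in>S. y \<le> B \<longrightarrow> local_mass F c (x - y) / \<alpha> x \<le> K"
    using left_part_bound[OF u0, where B = B] a0 by auto
  have "((\<lambda>x. \<integral>y. indicator {..B} y * (local_mass F c (x - y) / \<alpha> x) \<partial>N)
      \<longlongrightarrow> (\<integral>y. indicator {..B} y * a \<partial>N)) at_top"
  proof (rule integral_dominated_convergence_at_top[where w = "\<lambda>_. K"])
    show "AE y in N. ((\<lambda>x. indicator {..B} y * (local_mass F c (x - y) / \<alpha> x)) \<longlongrightarrow> indicator {..B} y * a) at_top"
      by (intro AE_I2 tendsto_mult tendsto_const ratio_shift_tendsto a)
    show "\<forall>\<^sub>F x in at_top. AE y in N. norm (indicator {..B} y * (local_mass F c (x - y) / \<alpha> x)) \<le> K"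
      using K(2)
    proof eventually_elim
      case (elim x)
      note b = this
      have "AE y in N. y \<in> S" using N by (simp add: carried_def)
      then show ?case
      proof eventually_elim
        case (elim y)
        have "0 \<le> local_mass F c (x - y) / \<alpha> x" by (simp add: local_mass_nonneg)
        then show ?case using b elim K(1) by (auto split: split_indicator)
      qed
    qed
  qed auto
  moreover have "(\<integral>y. indicator {..B} y * (local_mass F c (x - y) / \<alpha> x) \<partial>N) = left_part c F N B x / \<alpha> x" for x
    unfolding left_part_def times_divide_eq_right by simp
  moreover have "(\<integral>y. indicator {..B} y * a \<partial>N) = a * measure N {..B}" by simp
  ultimately show ?thesis by (simp only:)
qed

end

section \<open>Locally subexponential distributions\<close>

locale locally_subexponential = long_tailed_local +
  assumes carried_M: "carried S M"
    and self_convolution: "(ratio (convolution M M) \<longlongrightarrow> 2) at_top"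
begin

lemma joint_tail_self_tendsto:
  "((\<lambda>x. joint_tail c M M B x / \<alpha> x) \<longlongrightarrow> 2 - 2 * measure M {..B}) at_top"
proof -
  have "((\<lambda>x. ratio (convolution M M) x - 2 * (left_part c M M B x / \<alpha> x))
      \<longlongrightarrow> 2 - 2 * (1 * measure M {..B})) at_top"
    by (intro tendsto_diff tendsto_mult tendsto_const self_convolution
        left_part_ratio_tendsto real_distribution_M ratio_self_tendsto carried_M)
  moreover have "\<forall>\<^sub>F x in at_top. ratio (convolution M M) x - 2 * (left_part c M M B x / \<alpha> x)
      = joint_tail c M M B x / \<alpha> x"
    using eventually_ge_at_top[of "2 * B"]
    by eventually_elim
      (simp add: ratio_def local_mass_convolution_decomp[OF real_distribution_M real_distribution_M c, of B] add_divide_distrib)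
  ultimately show ?thesis by (simp add: Lim_transform_eventually)
qed

text \<open>
  Two applications of domination, with the roles of the summands exchanged in between, replace both
  distributions by \<open>M\<close>, and for \<open>M\<close> the limit \<open>2 - 2 M(-\<infinity>, B]\<close> of the joint tail vanishes as \<open>B\<close> grows.
\<close>

lemma joint_tail_negligible:
  assumes F: "real_distribution F" and N: "real_distribution N"
    and domF: "\<And>u. u0 \<le> u \<Longrightarrow> local_mass F c u \<le> C * \<alpha> u" and C: "0 \<le> C"
    and domN: "\<And>u. u0 \<le> u \<Longrightarrow> local_mass N c u \<le> D * \<alpha> u" and D: "0 \<le> D"
    and e: "0 < e"
  shows "\<forall>\<^sub>F B in at_top. \<forall>\<^sub>F x in at_top. joint_tail c F N B x / \<alpha> x \<le> e"
proof -
  have f: "filterlim (\<lambda>B. B - 2 * c) at_top at_top"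
    using filterlim_tendsto_add_at_top[OF tendsto_const[of "- (2 * c)"] filterlim_ident] by simp
  have "((\<lambda>B. C * D * (2 - 2 * measure M {..B - 2 * c})) \<longlongrightarrow> C * D * (2 - 2 * 1)) at_top"
    by (intro tendsto_intros filterlim_compose[OF measure_atMost_tendsto_1[OF real_distribution_M] f])
  then have "\<forall>\<^sub>F B in at_top. C * D * (2 - 2 * measure M {..B - 2 * c}) < e"
    by (rule order_tendstoD(2)) (use e in simp)
  then show ?thesis
    using eventually_ge_at_top[of "u0 + 2 * c"]
  proof eventually_elim
    case (elim B)
    have "((\<lambda>x. C * D * (joint_tail c M M (B - 2 * c) x / \<alpha> x))
        \<longlongrightarrow> C * D * (2 - 2 * measure M {..B - 2 * c})) at_top"
      by (intro tendsto_mult tendsto_const joint_tail_self_tendsto)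
    then have "\<forall>\<^sub>F x in at_top. C * D * (joint_tail c M M (B - 2 * c) x / \<alpha> x) < e"
      by (rule order_tendstoD(2)) (rule elim)
    then show ?case
      using eventually_pos
    proof eventually_elim
      case (elim x)
      have "joint_tail c F N B x \<le> C * joint_tail c M N (B - c) x"
        using \<open>u0 + 2 * c \<le> B\<close> c by (intro joint_tail_dominated[OF F N real_distribution_M c domF C]) auto
      also have "joint_tail c M N (B - c) x = joint_tail c N M (B - c) x"
        by (rule joint_tail_commute[OF real_distribution_M N])
      also have "\<dots> \<le> D * joint_tail c M M (B - c - c) x"
        using \<open>u0 + 2 * c \<le> B\<close> c by (intro joint_tail_dominated[OF N real_distribution_M real_distribution_M c domN D]) auto
      finally have "joint_tail c F N B x \<le> C * (D * joint_tail c M M (B - c - c) x)"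
        using C by (simp add: mult_left_mono)
      also have "B - c - c = B - 2 * c" by simp
      finally have "joint_tail c F N B x / \<alpha> x \<le> C * (D * joint_tail c M M (B - 2 * c) x) / \<alpha> x"
        using elim by (simp add: divide_right_mono)
      then show ?case using elim by simp
    qed
  qed
qed

lemma ratio_convolution_tendsto:
  assumes F: "carried S F" and a: "(ratio F \<longlongrightarrow> a) at_top"
    and N: "carried S N" and b: "(ratio N \<longlongrightarrow> b) at_top"
  shows "(ratio (convolution F N) \<longlongrightarrow> a + b) at_top"
proof (rule tendstoI)
  fix e :: real assume e: "0 < e"
  have rF: "real_distribution F" and rN: "real_distribution N" using F N by (auto simp: carried_def)
  have a0: "0 \<le> a" using tendsto_lowerbound[OF a] by (simp add: ratio_nonneg)
  have b0: "0 \<le> b" using tendsto_lowerbound[OF b] by (simp add: ratio_nonneg)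
  obtain u1 where u1: "\<And>u. u1 \<le> u \<Longrightarrow> local_mass F c u \<le> (a + 1) * \<alpha> u"
    using eventually_le_of_ratio[OF a, of "a + 1"] by auto
  obtain u2 where u2: "\<And>u. u2 \<le> u \<Longrightarrow> local_mass N c u \<le> (b + 1) * \<alpha> u"
    using eventually_le_of_ratio[OF b, of "b + 1"] by auto
  have jt: "\<forall>\<^sub>F B in at_top. \<forall>\<^sub>F x in at_top. joint_tail c F N B x / \<alpha> x \<le> e / 4"
    by (rule joint_tail_negligible[OF rF rN, of "max u1 u2" "a + 1" "b + 1"]) (use u1 u2 a0 b0 e in auto)
  have "((\<lambda>B. a * measure N {..B} + b * measure F {..B}) \<longlongrightarrow> a * 1 + b * 1) at_top"
    by (intro tendsto_intros measure_atMost_tendsto_1 rF rN)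
  then have "\<forall>\<^sub>F B in at_top. dist (a * measure N {..B} + b * measure F {..B}) (a * 1 + b * 1) < e / 4"
    by (rule tendstoD) (use e in simp)
  from eventually_happens'[OF trivial_limit_at_top_linorder eventually_conj[OF jt this]]
  obtain B where B: "\<forall>\<^sub>F x in at_top. joint_tail c F N B x / \<alpha> x \<le> e / 4"
    "dist (a * measure N {..B} + b * measure F {..B}) (a + b) < e / 4"
    unfolding mult_1_right by blast
  have "((\<lambda>x. left_part c F N B x / \<alpha> x + left_part c N F B x / \<alpha> x)
      \<longlongrightarrow> a * measure N {..B} + b * measure F {..B}) at_top"
    by (intro tendsto_add left_part_ratio_tendsto rF rN F N a b)
  then have "\<forall>\<^sub>F x in at_top. dist (left_part c F N B x / \<alpha> x + left_part c N F B x / \<alpha> x)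
      (a * measure N {..B} + b * measure F {..B}) < e / 4"
    by (rule tendstoD) (use e in simp)
  then show "\<forall>\<^sub>F x in at_top. dist (ratio (convolution F N) x) (a + b) < e"
    using B(1) eventually_pos eventually_ge_at_top[of "2 * B"]
  proof eventually_elim
    case (elim x)
    have "ratio (convolution F N) x = left_part c F N B x / \<alpha> x + left_part c N F B x / \<alpha> x
        + joint_tail c F N B x / \<alpha> x"
      by (simp add: ratio_def local_mass_convolution_decomp[OF rF rN c elim(4)] add_divide_distrib)
    moreover have "0 \<le> joint_tail c F N B x / \<alpha> x"
      using elim(3) by (simp add: joint_tail_def)
    ultimately show ?case using elim(1,2) B(2) e unfolding dist_real_def by linarith
  qed
qed

lemma ratio_conv_power_tendsto: "(ratio (conv_power M n) \<longlongrightarrow> real n) at_top"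
proof (induction n)
  case 0
  have "\<forall>\<^sub>F x in at_top. 0 = ratio (conv_power M 0) x"
    using eventually_ge_at_top[of 0] by eventually_elim (simp add: ratio_def local_mass_def measure_return)
  then show ?case unfolding of_nat_0 by (rule Lim_transform_eventually[OF tendsto_const])
next
  case (Suc n)
  have "(ratio (convolution M (conv_power M n)) \<longlongrightarrow> 1 + real n) at_top"
    by (intro ratio_convolution_tendsto carried_M ratio_self_tendsto Suc carried_conv_power S_cases)
  then show ?case by simp
qed

text \<open>
  A weak form of Kesten's bound. An arbitrary rate \<open>K\<close> is good enough since the Poisson weights decay faster
  than any geometric sequence; this makes the induction elementary. The sum of a summand with law \<open>M\<close> and
  one with law \<open>M\<^sup>n\<close> is split according to whether the latter is at most \<open>X + c\<close>, where \<open>left_bound\<close>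
  applies, or larger, where the former is less than \<open>x - X\<close> and the induction hypothesis reduces the
  estimate to \<open>M * M\<close>.
\<close>

lemma conv_power_geometric_bound:
  obtains K X where "1 \<le> K" "\<And>x. X \<le> x \<Longrightarrow> 0 < \<alpha> x"
    "\<And>n x. X \<le> x \<Longrightarrow> local_mass (conv_power M n) c x \<le> K ^ n * \<alpha> x"
proof -
  obtain X1 where X1: "0 \<le> X1" "\<And>x. X1 \<le> x \<Longrightarrow> 0 < \<alpha> x"
    "\<And>B. \<exists>C\<ge>1. \<forall>x\<ge>X1. \<forall>y\<in>S. y \<le> B \<longrightarrow> \<alpha> (x - y) \<le> C * \<alpha> x"
    using left_bound by blast
  obtain u0 where u0: "\<And>u. u0 \<le> u \<Longrightarrow> local_mass (convolution M M) c u \<le> 3 * \<alpha> u"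
    using eventually_le_of_ratio[OF self_convolution, of 3] by auto
  define X where "X = max X1 u0"
  obtain C where C: "1 \<le> C" "\<And>x y. X1 \<le> x \<Longrightarrow> y \<in> S \<Longrightarrow> y \<le> X + c \<Longrightarrow> \<alpha> (x - y) \<le> C * \<alpha> x"
    using X1(3)[of "X + c"] by blast
  have "local_mass (conv_power M n) c x \<le> (C + 3) ^ n * \<alpha> x" if "X \<le> x" for n x
    using that
  proof (induction n arbitrary: x)
    case 0
    have "local_mass (conv_power M 0) c x = 0"
      using 0 X1(1) by (simp add: local_mass_def measure_return X_def)
    then show ?case by (simp add: local_mass_nonneg)
  next
    case (Suc n)
    let ?N = "conv_power M n" and ?T = "X + c"
    let ?A = "{..<x + c - ?T}"
    let ?K = "(C + 3) ^ n"
    have N: "carried S ?N" by (rule carried_conv_power[OF S_cases carried_M])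
    then have rN: "real_distribution ?N" by (simp add: carried_def)
    interpret M: real_distribution M by (rule real_distribution_M)
    interpret N: real_distribution ?N by (rule rN)
    interpret P: pair_prob_space M ?N ..
    interpret Q: pair_prob_space M M ..
    have ax: "0 < \<alpha> x" using X1(2) Suc.prems by (simp add: X_def)
    have K1: "1 \<le> ?K" using C(1) by simp
    let ?E1 = "{z. snd z \<in> {..?T} \<and> x < fst z + snd z \<and> fst z + snd z \<le> x + c}"
    let ?E2 = "{z. fst z \<in> ?A \<and> x < fst z + snd z \<and> fst z + snd z \<le> x + c}"
    have m: "?E1 \<in> P.events" "?E2 \<in> P.events"
      unfolding sets_pair_real_distribution[OF real_distribution_M rN] by (rule sets_pair_borelI, measurable)+
    have "local_mass (conv_power M (Suc n)) c x \<le> measure (M \<Otimes>\<^sub>M ?N) (?E1 \<union> ?E2)"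
      unfolding conv_power.simps local_mass_convolution[OF real_distribution_M rN]
      by (rule P.finite_measure_mono) (use m in auto)
    also have "\<dots> \<le> measure (M \<Otimes>\<^sub>M ?N) ?E1 + measure (M \<Otimes>\<^sub>M ?N) ?E2"
      by (rule measure_Un_le) (use m in auto)
    also have "measure (M \<Otimes>\<^sub>M ?N) ?E1 \<le> C * \<alpha> x"
    proof -
      have "measure (M \<Otimes>\<^sub>M ?N) ?E1 = (\<integral>y. indicator {..?T} y * \<alpha> (x - y) \<partial>?N)"
        by (rule measure_pair_snd_slice[OF real_distribution_M rN c]) simp
      also have "\<dots> \<le> (\<integral>y. C * \<alpha> x \<partial>?N)"
      proof (rule integral_mono_AE)
        have "AE y in ?N. y \<in> S" using N by (simp add: carried_def)
        then show "AE y in ?N. indicator {..?T} y * \<alpha> (x - y) \<le> C * \<alpha> x"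
        proof eventually_elim
          case (elim y)
          then show ?case using C(2)[of x y] Suc.prems C(1) ax
            by (auto simp: X_def split: split_indicator)
        qed
      qed (auto intro!: integrable_indicator_local_mass real_distribution_M rN c)
      finally show ?thesis using N.prob_space by simp
    qed
    also have "measure (M \<Otimes>\<^sub>M ?N) ?E2 \<le> ?K * (3 * \<alpha> x)"
    proof -
      have "measure (M \<Otimes>\<^sub>M ?N) ?E2 = (\<integral>y. indicator ?A y * local_mass ?N c (x - y) \<partial>M)"
        by (rule measure_pair_fst_slice[OF real_distribution_M rN c]) simp
      also have "\<dots> \<le> (\<integral>y. ?K * (indicator ?A y * \<alpha> (x - y)) \<partial>M)"
      proof (rule integral_mono)
        show "indicator ?A y * local_mass ?N c (x - y) \<le> ?K * (indicator ?A y * \<alpha> (x - y))" for y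
          using Suc.IH[of "x - y"] by (auto split: split_indicator)
      qed (auto intro!: integrable_indicator_local_mass real_distribution_M rN c)
      also have "\<dots> = ?K * measure (M \<Otimes>\<^sub>M M) {z. snd z \<in> ?A \<and> x < fst z + snd z \<and> fst z + snd z \<le> x + c}"
        by (subst measure_pair_snd_slice[OF real_distribution_M real_distribution_M c]) auto
      also have "\<dots> \<le> ?K * local_mass (convolution M M) c x"
        unfolding local_mass_convolution[OF real_distribution_M real_distribution_M]
      proof (intro mult_left_mono Q.finite_measure_mono)
        show "{z. x < fst z + snd z \<and> fst z + snd z \<le> x + c} \<in> Q.events"
          unfolding sets_pair_real_distribution[OF real_distribution_M real_distribution_M] by (rule sets_pair_borelI) measurable
      qed (use K1 in auto)
      also have "\<dots> \<le> ?K * (3 * \<alpha> x)"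
        using u0[of x] Suc.prems K1 by (intro mult_left_mono) (auto simp: X_def)
      finally show ?thesis .
    qed
    also have "C * \<alpha> x + ?K * (3 * \<alpha> x) \<le> ?K * (C * \<alpha> x) + ?K * (3 * \<alpha> x)"
      using K1 C(1) ax by simp
    also have "\<dots> = (C + 3) ^ Suc n * \<alpha> x" by (simp add: algebra_simps)
    finally show ?case by simp
  qed
  then show thesis
    using that[of "C + 3" X] C(1) X1(2) by (auto simp: X_def)
qed

lemma ratio_compound_poisson_tendsto:
  assumes l: "0 < l"
  shows "(ratio (compound_poisson l M) \<longlongrightarrow> l) at_top"
proof -
  obtain K X where K: "1 \<le> K" "\<And>x. X \<le> x \<Longrightarrow> 0 < \<alpha> x"
    "\<And>n x. X \<le> x \<Longrightarrow> local_mass (conv_power M n) c x \<le> K ^ n * \<alpha> x"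
    by (rule conv_power_geometric_bound) (rule that)
  let ?a = "\<lambda>n x. l ^ n / fact n * ratio (conv_power M n) x"
  note sK = sums_summable[OF exp_sums_divide[of "l * K"]]
  have lim: "((\<lambda>x. \<Sum>n. ?a n x) \<longlongrightarrow> (\<Sum>n. l ^ n / fact n * real n)) at_top"
  proof (rule tannerys_theorem[THEN conjunct2, THEN conjunct2])
    show "((\<lambda>x. ?a n x) \<longlongrightarrow> l ^ n / fact n * real n) at_top" for n
      by (intro tendsto_mult tendsto_const ratio_conv_power_tendsto)
    have "norm (?a n x) \<le> (l * K) ^ n / fact n" if "X \<le> x" for n x
    proof -
      have "ratio (conv_power M n) x \<le> K ^ n"
        using K(3)[OF that, of n] K(2)[OF that] by (simp add: ratio_def divide_le_eq)
      then have "?a n x \<le> l ^ n / fact n * K ^ n"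
        using l by (intro mult_left_mono) auto
      then show ?thesis using l by (simp add: ratio_nonneg power_mult_distrib)
    qed
    then show "\<forall>\<^sub>F (n, x) in at_top \<times>\<^sub>F at_top. norm (?a n x) \<le> (l * K) ^ n / fact n"
      unfolding eventually_prod_filter prod.case
      by (intro exI[of _ "\<lambda>_. True"] exI[of _ "\<lambda>x. X \<le> x"] conjI eventually_True
          eventually_ge_at_top) blast
    show "summable (\<lambda>n. (l * K) ^ n / fact n)" by (rule sK)
  qed simp
  have "((\<lambda>x. exp (- l) * (\<Sum>n. ?a n x)) \<longlongrightarrow> exp (- l) * (l * exp l)) at_top"
    unfolding sums_unique[OF poisson_mean_sums] by (intro tendsto_mult tendsto_const lim)
  also have "exp (- l) * (l * exp l) = l" by (simp add: exp_minus)
  also have "(\<lambda>x. exp (- l) * (\<Sum>n. ?a n x)) = ratio (compound_poisson l M)"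
    unfolding sums_unique[OF ratio_compound_poisson_sums[OF l], symmetric]
    by (rule ext) (simp add: mult_exp_exp flip: mult.assoc)
  finally show ?thesis .
qed

end

section \<open>From the limit of the ratio to subexponentiality\<close>

context long_tailed_local
begin

text \<open>
  Dropping the nonnegative joint tail from the splitting leaves the two left parts, whose limits bound the
  ratio from below.
\<close>

lemma ratio_convolution_lower_bound:
  assumes cM: "carried S M" and cF: "carried S F"
    and low: "\<And>e. 0 < e \<Longrightarrow> \<forall>\<^sub>F x in at_top. a - e \<le> ratio F x" and e: "0 < e"
  shows "\<forall>\<^sub>F x in at_top. 1 + a - e \<le> ratio (convolution M F) x"
proof -
  have rF: "real_distribution F" using cF by (simp add: carried_def)
  define d where "d = e / 3"
  have d: "0 < d" using e by (simp add: d_def)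
  obtain u0 where u0: "\<And>u. u0 \<le> u \<Longrightarrow> a - d \<le> ratio F u \<and> 0 < \<alpha> u"
    using eventually_conj[OF low[OF d] eventually_pos] unfolding eventually_at_top_linorder by blast
  have "((\<lambda>B. measure F {..B} + (a - d) * measure M {..B}) \<longlongrightarrow> 1 + (a - d) * 1) at_top"
    by (intro tendsto_intros measure_atMost_tendsto_1 rF real_distribution_M)
  then have "\<forall>\<^sub>F B in at_top. 1 + a - 2 * d < measure F {..B} + (a - d) * measure M {..B}"
    by (rule order_tendstoD(1)) (use d in simp)
  from eventually_happens'[OF trivial_limit_at_top_linorder this]
  obtain B where B: "1 + a - 2 * d < measure F {..B} + (a - d) * measure M {..B}" by blast
  have "((\<lambda>x. left_part c M F B x / \<alpha> x + (a - d) * (left_part c M M B x / \<alpha> x))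
      \<longlongrightarrow> 1 * measure F {..B} + (a - d) * (1 * measure M {..B})) at_top"
    by (intro tendsto_add tendsto_mult tendsto_const left_part_ratio_tendsto real_distribution_M ratio_self_tendsto cM cF)
  then have "\<forall>\<^sub>F x in at_top. 1 + a - 2 * d
      < left_part c M F B x / \<alpha> x + (a - d) * (left_part c M M B x / \<alpha> x)"
    by (rule order_tendstoD(1)) (use B in simp)
  then show ?thesis
    using eventually_pos eventually_ge_at_top[of "2 * B"] eventually_ge_at_top[of "u0 + B"]
  proof eventually_elim
    case (elim x)
    have "(a - d) * left_part c M M B x = (\<integral>y. (a - d) * (indicator {..B} y * \<alpha> (x - y)) \<partial>M)"
      by (simp add: left_part_def)
    also have "\<dots> \<le> left_part c F M B x"
      unfolding left_part_def
    proof (rule integral_mono)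
      fix y
      show "(a - d) * (indicator {..B} y * \<alpha> (x - y)) \<le> indicator {..B} y * local_mass F c (x - y)"
        using u0[of "x - y"] elim(4) by (auto simp: ratio_def le_divide_eq split: split_indicator)
    qed (auto intro!: integrable_indicator_local_mass real_distribution_M rF c)
    finally have "(a - d) * (left_part c M M B x / \<alpha> x) \<le> left_part c F M B x / \<alpha> x"
      using elim(2) by (simp add: divide_right_mono)
    moreover have "ratio (convolution M F) x = left_part c M F B x / \<alpha> x + left_part c F M B x / \<alpha> x
        + joint_tail c M F B x / \<alpha> x"
      by (simp add: ratio_def local_mass_convolution_decomp[OF real_distribution_M rF c elim(3)] add_divide_distrib)
    moreover have "0 \<le> joint_tail c M F B x / \<alpha> x"
      using elim(2) by (simp add: joint_tail_def)
    ultimately show ?case using elim(1) d unfolding d_def by linarith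
  qed
qed

lemma ratio_conv_power_lower_bound:
  assumes cM: "carried S M" and e: "0 < e"
  shows "\<forall>\<^sub>F x in at_top. real n - e \<le> ratio (conv_power M n) x"
  using e
proof (induction n arbitrary: e)
  case 0
  show ?case using 0 by (intro always_eventually allI order_trans[OF _ ratio_nonneg]) simp
next
  case (Suc n)
  have "\<forall>\<^sub>F x in at_top. 1 + real n - e \<le> ratio (convolution M (conv_power M n)) x"
    by (rule ratio_convolution_lower_bound[OF cM carried_conv_power[OF S_cases cM] Suc.IH Suc.prems])
  then show ?case by simp
qed

text \<open>
  The terms of the series for \<open>e\<^sup>l \<mu> / M\<close> have lower limits \<open>n l\<^sup>n / n!\<close>, whose sum \<open>l e\<^sup>l\<close> is the limit of the
  whole series. Hence the second term cannot have a larger upper limit than \<open>2 l\<^sup>2 / 2!\<close>.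
\<close>

lemma self_convolution_of_compound_poisson:
  assumes l: "0 < l" and cM: "carried S M" and lim: "(ratio (compound_poisson l M) \<longlongrightarrow> l) at_top"
  shows "(ratio (convolution M M) \<longlongrightarrow> 2) at_top"
proof -
  define w where "w n = l ^ n / fact n" for n :: nat
  have w: "0 < w n" for n using l by (simp add: w_def)
  have c2: "conv_power M 2 = convolution M M" by (rule conv_power_2[OF real_distribution_M])
  have upper: "\<forall>\<^sub>F x in at_top. ratio (conv_power M 2) x < 2 + e" if e: "0 < e" for e
  proof -
    (* The error d is spent once in truncating the series of means, and with factor exp l once in the
       limit of the ratio and once in the lower bounds of the terms. *)
    define d where "d = w 2 * e / (2 * (1 + 2 * exp l))"
    have p: "0 < 1 + 2 * exp l" by (simp add: add_pos_pos)
    have d: "0 < d" using w[of 2] e p by (simp add: d_def)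
    have dd: "(1 + 2 * exp l) * d < w 2 * e"
      using w[of 2] e p by (simp add: d_def divide_simps)
    have "(\<lambda>N. \<Sum>n<N. w n * real n) \<longlonglongrightarrow> l * exp l"
      using poisson_mean_sums[of l] by (simp add: sums_def w_def)
    then have "\<forall>\<^sub>F N in sequentially. l * exp l - d < (\<Sum>n<N. w n * real n)"
      by (rule order_tendstoD(1)) (use d in simp)
    from eventually_happens'[OF sequentially_bot eventually_conj[OF this eventually_gt_at_top[of 2]]]
    obtain N where N: "l * exp l - d < (\<Sum>n<N. w n * real n)" "2 < N" by blast
    have sw: "w sums exp l" unfolding w_def[abs_def] by (rule exp_sums_divide)
    have wN: "(\<Sum>n\<in>{..<N} - {2}. w n) \<le> exp l"
      unfolding sums_unique[OF sw] using w
      by (intro sum_le_suminf sums_summable[OF sw]) (auto intro: less_imp_le)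
    have "\<forall>\<^sub>F x in at_top. \<forall>n\<in>{..<N}. real n - d \<le> ratio (conv_power M n) x"
      by (intro eventually_ball_finite ballI ratio_conv_power_lower_bound cM d) simp
    moreover have "\<forall>\<^sub>F x in at_top. ratio (compound_poisson l M) x < l + d"
      by (rule order_tendstoD(2)[OF lim]) (use d in simp)
    ultimately show ?thesis
    proof eventually_elim
      case (elim x)
      let ?r = "\<lambda>n. ratio (conv_power M n) x"
      have s: "(\<lambda>n. w n * ?r n) sums (exp l * ratio (compound_poisson l M) x)"
        using ratio_compound_poisson_sums[OF l, of x] by (simp add: w_def)
      have "(\<Sum>n\<in>{..<N} - {2}. w n * real n) - d * (\<Sum>n\<in>{..<N} - {2}. w n)
          = (\<Sum>n\<in>{..<N} - {2}. w n * (real n - d))"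
        by (simp add: right_diff_distrib sum_subtractf sum_distrib_left mult.commute)
      also have "\<dots> \<le> (\<Sum>n\<in>{..<N} - {2}. w n * ?r n)"
        using elim(1) w by (intro sum_mono mult_left_mono) (auto simp: less_imp_le)
      finally have 1: "(\<Sum>n\<in>{..<N} - {2}. w n * real n) - d * (\<Sum>n\<in>{..<N} - {2}. w n)
          \<le> (\<Sum>n\<in>{..<N} - {2}. w n * ?r n)" .
      have 2: "d * (\<Sum>n\<in>{..<N} - {2}. w n) \<le> d * exp l" using wN d by simp
      have 3: "(\<Sum>n<N. w n * real n) = w 2 * 2 + (\<Sum>n\<in>{..<N} - {2}. w n * real n)"
        using N(2) by (subst sum.remove[of _ 2]) auto
      have 4: "(\<Sum>n<N. w n * ?r n) = w 2 * ?r 2 + (\<Sum>n\<in>{..<N} - {2}. w n * ?r n)"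
        using N(2) by (subst sum.remove[of _ 2]) auto
      have "(\<Sum>n<N. w n * ?r n) \<le> exp l * ratio (compound_poisson l M) x"
        using sum_le_suminf[OF sums_summable[OF s], of "{..<N}"] sums_unique[OF s] w
        by (simp add: ratio_nonneg less_imp_le)
      also have "\<dots> \<le> exp l * (l + d)" using elim(2) by simp
      finally have 5: "(\<Sum>n<N. w n * ?r n) \<le> l * exp l + d * exp l" by (simp add: algebra_simps)
      have "w 2 * ?r 2 < w 2 * (2 + e)"
        using 1 2 3 4 5 N(1) dd by (simp add: algebra_simps)
      then show "?r 2 < 2 + e" using w[of 2] by (simp add: mult_less_cancel_left)
    qed
  qed
  have "(ratio (conv_power M 2) \<longlongrightarrow> 2) at_top"
  proof (rule tendstoI)
    fix e :: real assume e: "0 < e"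
    have "\<forall>\<^sub>F x in at_top. real 2 - e / 2 \<le> ratio (conv_power M 2) x"
      using e by (intro ratio_conv_power_lower_bound cM) simp
    with upper[OF e] show "\<forall>\<^sub>F x in at_top. dist (ratio (conv_power M 2) x) 2 < e"
      by eventually_elim (use e in \<open>simp add: dist_real_def abs_less_iff\<close>)
  qed
  then show ?thesis by (simp only: c2)
qed

end

section \<open>Convolution square roots of compound Poisson distributions\<close>

context locally_subexponential
begin

text \<open>
  Asymptotic halving: with \<open>\<nu> * \<nu> = M\<close>, the splitting only says that the average
  \<open>\<integral> \<nu>(x - y + \<Delta>) / M(x + \<Delta>) \<nu>(dy)\<close> tends to \<open>1/2\<close>, and \<open>\<nu>\<close> is not known to be long-tailed. The same
  limit holds for all translates by \<open>z \<in> S\<close>, and the convolution inverse of \<open>\<nu>\<close>, which is carried by \<open>S\<close>,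
  extracts from these the limit of the integrand at \<open>y = 0\<close>.
\<close>

lemma half_ratio_tendsto:
  assumes l: "0 < l" and G: "carried S G" and M_eq: "M = compound_poisson (2 * l) G"
  shows "(ratio (compound_poisson l G) \<longlongrightarrow> 1 / 2) at_top"
proof -
  define \<nu> where "\<nu> = compound_poisson l G"
  have rG: "real_distribution G" using G by (simp add: carried_def)
  have c\<nu>: "carried S \<nu>" unfolding \<nu>_def by (rule carried_compound_poisson[OF S_cases l G])
  then have r\<nu>: "real_distribution \<nu>" by (simp add: carried_def)
  interpret N: real_distribution \<nu> by (rule r\<nu>)
  note [measurable] = borel_measurable_local_mass[OF r\<nu> c]
  have \<nu>\<nu>: "convolution \<nu> \<nu> = M"
    unfolding \<nu>_def M_eq mult_2 by (rule compound_poisson_convolution[OF l l rG])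
  define C where "C = exp l"
  have C: "0 < C" by (simp add: C_def)
  have dom: "local_mass \<nu> c u \<le> C * \<alpha> u" for u
    using compound_poisson_mono[OF l _ rG greaterThanAtMost_borel, of "2 * l" u "u + c"] l
    by (simp add: local_mass_def \<nu>_def M_eq C_def)
  define g where "g x y = local_mass \<nu> c (x - y) / \<alpha> x" for x y
  (* The ratios g x are not bounded uniformly in x and y. Truncating them at twice their asymptotic
     bound C changes nothing at a fixed y for large x, and gives functions to which the inversion
     formula and dominated convergence apply. *)
  define h where "h x y = min (g x y) (2 * C)" for x y
  have g0: "0 \<le> g x y" for x y by (simp add: g_def local_mass_nonneg)
  have h0: "0 \<le> h x y" "h x y \<le> 2 * C" for x y using g0 C by (auto simp: h_def)
  have habs: "\<bar>h x y\<bar> \<le> 2 * C" for x y using h0[of x y] by simp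
  have [measurable]: "g x \<in> borel_measurable borel" for x
    unfolding g_def[abs_def] by measurable
  have hm [measurable]: "h x \<in> borel_measurable borel" for x
    unfolding h_def[abs_def] by measurable
  have clip: "\<forall>\<^sub>F x in at_top. g x y = h x y" for y
  proof -
    have "\<forall>\<^sub>F x in at_top. \<alpha> (x - y) / \<alpha> x < 2"
      by (rule order_tendstoD(2)[OF shift_ratio_tendsto]) simp
    then show ?thesis
      using eventually_pos
    proof eventually_elim
      case (elim x)
      have "g x y \<le> C * (\<alpha> (x - y) / \<alpha> x)"
        using dom[of "x - y"] elim(2) by (simp add: g_def divide_right_mono)
      also have "\<dots> \<le> C * 2" using elim(1) C by (intro mult_left_mono) auto
      finally show ?case by (simp add: h_def)
    qed
  qed
  have average: "((\<lambda>x. \<integral>y. h x (z + y) \<partial>\<nu>) \<longlongrightarrow> 1 / 2) at_top" if z: "z \<in> S" for z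
  proof (rule tendstoI)
    fix e :: real assume e: "0 < e"
    have jt: "\<forall>\<^sub>F B in at_top. \<forall>\<^sub>F x in at_top. joint_tail c \<nu> \<nu> B x / \<alpha> x \<le> e / 8"
      by (rule joint_tail_negligible[OF r\<nu> r\<nu> dom _ dom]) (use C e in auto)
    have "((\<lambda>B. 2 * C * (1 - measure \<nu> {..B})) \<longlongrightarrow> 2 * C * (1 - 1)) at_top"
      by (intro tendsto_intros measure_atMost_tendsto_1 r\<nu>)
    then have "\<forall>\<^sub>F B in at_top. 2 * C * (1 - measure \<nu> {..B}) < e / 8"
      by (rule order_tendstoD(2)) (use e in simp)
    from eventually_happens'[OF trivial_limit_at_top_linorder eventually_conj[OF jt this]]
    obtain B where B: "\<forall>\<^sub>F x in at_top. joint_tail c \<nu> \<nu> B x / \<alpha> x \<le> e / 8"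
      and tail: "2 * C * (1 - measure \<nu> {..B}) < e / 8"
      by blast
    have shift: "filterlim (\<lambda>x. x - z) at_top at_top"
      using filterlim_tendsto_add_at_top[OF tendsto_const[of "- z"] filterlim_ident] by simp
    (* The two left parts of a square agree, so each carries half of what the joint tail leaves. *)
    define p where "p x = left_part c \<nu> \<nu> B x / \<alpha> x" for x
    have p_bounds: "\<forall>\<^sub>F x in at_top. 1 / 2 - e / 16 \<le> p x \<and> p x \<le> 1 / 2"
      using B eventually_pos eventually_ge_at_top[of "2 * B"]
    proof eventually_elim
      case (elim x)
      have decomp: "2 * left_part c \<nu> \<nu> B x + joint_tail c \<nu> \<nu> B x = \<alpha> x"
        using local_mass_convolution_decomp[OF r\<nu> r\<nu> c elim(3)] by (simp add: \<nu>\<nu>)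
      have "2 * p x + joint_tail c \<nu> \<nu> B x / \<alpha> x
          = (2 * left_part c \<nu> \<nu> B x + joint_tail c \<nu> \<nu> B x) / \<alpha> x"
        by (simp add: p_def add_divide_distrib)
      also have "\<dots> = 1" unfolding decomp using elim(2) by simp
      finally have "2 * p x + joint_tail c \<nu> \<nu> B x / \<alpha> x = 1" .
      moreover have "0 \<le> joint_tail c \<nu> \<nu> B x / \<alpha> x"
        using elim(2) by (simp add: joint_tail_def)
      ultimately show ?case using elim(1) by linarith
    qed
    have p: "\<forall>\<^sub>F x in at_top. 1 / 2 - e / 16 \<le> p (x - z) \<and> p (x - z) \<le> 1 / 2"
      by (rule eventually_compose_filterlim[OF p_bounds shift])
    have q: "\<forall>\<^sub>F x in at_top. dist (\<alpha> (x - z) / \<alpha> x) 1 < min (e / 16) 1"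
      by (rule tendstoD[OF shift_ratio_tendsto]) (use e in simp)
    let ?I = "\<lambda>y. indicator {..B} y :: real"
    have L: "\<forall>\<^sub>F x in at_top. \<bar>(\<integral>y. ?I y * g x (z + y) \<partial>\<nu>) - 1 / 2\<bar> \<le> e / 8"
      using p q eventually_pos eventually_compose_filterlim[OF eventually_pos shift]
    proof eventually_elim
      case (elim x)
      have "(\<integral>y. ?I y * g x (z + y) \<partial>\<nu>) = (\<integral>y. ?I y * local_mass \<nu> c (x - z - y) / \<alpha> x \<partial>\<nu>)"
        by (simp add: g_def algebra_simps)
      also have "\<dots> = left_part c \<nu> \<nu> B (x - z) / \<alpha> x" by (simp add: left_part_def)
      also have "\<dots> = p (x - z) * (\<alpha> (x - z) / \<alpha> x)" using elim(4) by (simp add: p_def)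
      finally have i: "(\<integral>y. ?I y * g x (z + y) \<partial>\<nu>) = p (x - z) * (\<alpha> (x - z) / \<alpha> x)" .
      have p0: "0 \<le> p (x - z)"
        using elim(4) by (simp add: p_def left_part_def integral_nonneg_AE local_mass_nonneg)
      have "p (x - z) * (\<alpha> (x - z) / \<alpha> x) - 1 / 2
          = (p (x - z) - 1 / 2) + p (x - z) * (\<alpha> (x - z) / \<alpha> x - 1)"
        by (simp add: algebra_simps)
      also have "\<bar>\<dots>\<bar> \<le> \<bar>p (x - z) - 1 / 2\<bar> + \<bar>p (x - z) * (\<alpha> (x - z) / \<alpha> x - 1)\<bar>"
        by (rule abs_triangle_ineq)
      also have "\<bar>p (x - z) - 1 / 2\<bar> \<le> e / 16" using elim(1) by linarith
      also have "\<bar>p (x - z) * (\<alpha> (x - z) / \<alpha> x - 1)\<bar> \<le> 1 * (e / 16)"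
        unfolding abs_mult using elim(1,2) p0 by (intro mult_mono) (auto simp: dist_real_def)
      finally show ?case unfolding i by simp
    qed
    (* To the left of B the truncation is asymptotically invisible. *)
    have D: "((\<lambda>x. \<integral>y. ?I y * (g x (z + y) - h x (z + y)) \<partial>\<nu>) \<longlongrightarrow> (\<integral>y. 0 \<partial>\<nu>)) at_top"
    proof -
      obtain K where K: "0 \<le> K"
        "\<forall>\<^sub>F x in at_top. \<forall>y\<in>S. y \<le> z + B \<longrightarrow> local_mass \<nu> c (x - y) / \<alpha> x \<le> K"
        using left_part_bound[OF dom less_imp_le[OF C], where B = "z + B"] by blast
      show ?thesis
      proof (rule integral_dominated_convergence_at_top[where w = "\<lambda>_. K"])
        show "AE y in \<nu>. ((\<lambda>x. ?I y * (g x (z + y) - h x (z + y))) \<longlongrightarrow> 0) at_top"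
        proof (rule AE_I2)
          fix y
          have "\<forall>\<^sub>F x in at_top. 0 = ?I y * (g x (z + y) - h x (z + y))"
            using clip[of "z + y"] by (rule eventually_mono) simp
          then show "((\<lambda>x. ?I y * (g x (z + y) - h x (z + y))) \<longlongrightarrow> 0) at_top"
            by (rule Lim_transform_eventually[OF tendsto_const])
        qed
        show "\<forall>\<^sub>F x in at_top. AE y in \<nu>. norm (?I y * (g x (z + y) - h x (z + y))) \<le> K"
          using K(2)
        proof (rule eventually_mono)
          fix x assume b: "\<forall>y\<in>S. y \<le> z + B \<longrightarrow> local_mass \<nu> c (x - y) / \<alpha> x \<le> K"
          have "AE y in \<nu>. y \<in> S" using c\<nu> by (simp add: carried_def)
          then show "AE y in \<nu>. norm (?I y * (g x (z + y) - h x (z + y))) \<le> K"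
          proof (rule eventually_mono)
            fix y assume y: "y \<in> S"
            have "z + y \<in> S" using S_cases y z by auto
            then have "y \<le> B \<Longrightarrow> g x (z + y) \<le> K" using b by (simp add: g_def)
            moreover have "\<bar>g x (z + y) - h x (z + y)\<bar> \<le> g x (z + y)"
              using g0[of x "z + y"] C by (auto simp: h_def min_def)
            ultimately show "norm (?I y * (g x (z + y) - h x (z + y))) \<le> K"
              using K(1) by (auto split: split_indicator)
          qed
        qed
      qed auto
    qed
    have "\<forall>\<^sub>F x in at_top. dist (\<integral>y. ?I y * (g x (z + y) - h x (z + y)) \<partial>\<nu>) (\<integral>y. 0 \<partial>\<nu>) < e / 8"
      by (rule tendstoD[OF D]) (use e in simp)
    then show "\<forall>\<^sub>F x in at_top. dist (\<integral>y. h x (z + y) \<partial>\<nu>) (1 / 2) < e"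
      using L eventually_pos
    proof eventually_elim
      case (elim x)
      have "norm (?I y * g x (z + y)) \<le> 1 / \<alpha> x" for y
      proof -
        have "g x (z + y) \<le> 1 / \<alpha> x"
          using local_mass_le_1[OF r\<nu>] elim(3) by (simp add: g_def divide_right_mono)
        then show ?thesis using g0[of x "z + y"] elim(3) by (auto split: split_indicator)
      qed
      then have ig: "integrable \<nu> (\<lambda>y. ?I y * g x (z + y))"
        by (intro N.integrable_const_bound[of _ "1 / \<alpha> x"] AE_I2) auto
      have ih: "integrable \<nu> (\<lambda>y. ?I y * h x (z + y))" "integrable \<nu> (\<lambda>y. indicator {B<..} y * h x (z + y))"
        using habs C by (auto intro!: N.integrable_const_bound[of _ "2 * C"] AE_I2
            simp: abs_mult split: split_indicator)
      have ic: "integrable \<nu> (\<lambda>y. indicator {B<..} y * (2 * C))"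
        by (intro integrable_mult_left N.integrable_const_bound[of _ 1]) auto
      have "(\<integral>y. h x (z + y) \<partial>\<nu>) = (\<integral>y. ?I y * h x (z + y) + indicator {B<..} y * h x (z + y) \<partial>\<nu>)"
        by (intro Bochner_Integration.integral_cong) (auto split: split_indicator)
      also have "\<dots> = (\<integral>y. ?I y * h x (z + y) \<partial>\<nu>) + (\<integral>y. indicator {B<..} y * h x (z + y) \<partial>\<nu>)"
        by (rule Bochner_Integration.integral_add[OF ih(1,2)])
      finally have 1: "(\<integral>y. h x (z + y) \<partial>\<nu>)
          = (\<integral>y. ?I y * h x (z + y) \<partial>\<nu>) + (\<integral>y. indicator {B<..} y * h x (z + y) \<partial>\<nu>)" .
      have 2: "(\<integral>y. ?I y * (g x (z + y) - h x (z + y)) \<partial>\<nu>)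
          = (\<integral>y. ?I y * g x (z + y) \<partial>\<nu>) - (\<integral>y. ?I y * h x (z + y) \<partial>\<nu>)"
        unfolding right_diff_distrib by (rule Bochner_Integration.integral_diff[OF ig ih(1)])
      have 3: "0 \<le> (\<integral>y. indicator {B<..} y * h x (z + y) \<partial>\<nu>)"
        using h0 by (intro integral_nonneg_AE AE_I2) auto
      have "(\<integral>y. indicator {B<..} y * h x (z + y) \<partial>\<nu>) \<le> (\<integral>y. indicator {B<..} y * (2 * C) \<partial>\<nu>)"
        using h0 by (intro integral_mono[OF ih(2) ic]) (auto split: split_indicator)
      also have "\<dots> = 2 * C * measure \<nu> {B<..}" by simp
      also have "measure \<nu> {B<..} = 1 - measure \<nu> {..B}"
      proof -
        have "{B<..} = space \<nu> - {..B}" by auto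
        then show ?thesis by (simp only: N.prob_compl[of "{..B}"] N.events_eq_borel atMost_borel)
      qed
      finally have 4: "(\<integral>y. indicator {B<..} y * h x (z + y) \<partial>\<nu>) \<le> 2 * C * (1 - measure \<nu> {..B})" .
      show ?case
        using 1 2 3 4 elim(1,2) tail e unfolding dist_real_def Bochner_Integration.integral_zero
        by linarith
    qed
  qed
  have inner_bound: "\<bar>\<integral>y. h x (z + y) \<partial>\<nu>\<bar> \<le> 2 * C" for x z
    by (rule abs_integral_real_distribution_le[OF r\<nu>]) (use habs in auto)
  have inner_measurable [measurable]: "(\<lambda>z. \<integral>y. h x (z + y) \<partial>\<nu>) \<in> borel_measurable borel" for x
    by (rule borel_measurable_integral_translate[OF r\<nu> r\<nu> hm habs])
  let ?A = "\<lambda>m x. \<integral>z. (\<integral>y. h x (z + y) \<partial>\<nu>) \<partial>conv_power G m"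
  have A_lim: "((\<lambda>x. ?A m x) \<longlongrightarrow> 1 / 2) at_top" for m
  proof -
    have cm: "carried S (conv_power G m)" by (rule carried_conv_power[OF S_cases G])
    then interpret Gm: real_distribution "conv_power G m" by (simp add: carried_def)
    have "((\<lambda>x. ?A m x) \<longlongrightarrow> (\<integral>z. 1 / 2 \<partial>conv_power G m)) at_top"
    proof (rule integral_dominated_convergence_at_top[where w = "\<lambda>_. 2 * C"])
      show "AE z in conv_power G m. ((\<lambda>x. \<integral>y. h x (z + y) \<partial>\<nu>) \<longlongrightarrow> 1 / 2) at_top"
        by (rule eventually_mono[OF conjunct2[OF cm[unfolded carried_def]] average])
      show "\<forall>\<^sub>F x in at_top. AE z in conv_power G m. norm (\<integral>y. h x (z + y) \<partial>\<nu>) \<le> 2 * C"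
        using inner_bound by (intro always_eventually allI AE_I2) simp
    qed auto
    then show ?thesis using Gm.prob_space by simp
  qed
  have A_bound: "\<bar>?A m x\<bar> \<le> 2 * C" for m x
    by (rule abs_integral_real_distribution_le[OF real_distribution_conv_power[OF rG] inner_measurable inner_bound])
  have "((\<lambda>x. \<Sum>m. (- l) ^ m / fact m * ?A m x) \<longlongrightarrow> (\<Sum>m. (- l) ^ m / fact m * (1 / 2))) at_top"
  proof (rule tannerys_theorem[THEN conjunct2, THEN conjunct2])
    show "((\<lambda>x. (- l) ^ m / fact m * ?A m x) \<longlongrightarrow> (- l) ^ m / fact m * (1 / 2)) at_top" for m
      by (intro tendsto_mult tendsto_const A_lim)
    have "norm ((- l) ^ m / fact m * ?A m x) \<le> l ^ m / fact m * (2 * C)" for m x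
      using mult_left_mono[OF A_bound[of m x], of "l ^ m / fact m"] l by (simp add: abs_mult power_abs)
    then show "\<forall>\<^sub>F (m, x) in at_top \<times>\<^sub>F at_top. norm ((- l) ^ m / fact m * ?A m x) \<le> l ^ m / fact m * (2 * C)"
      by (intro always_eventually) auto
    show "summable (\<lambda>m. l ^ m / fact m * (2 * C))"
      by (intro summable_mult2 sums_summable[OF exp_sums_divide])
  qed simp
  also have "(\<Sum>m. (- l) ^ m / fact m * (1 / 2)) = exp (- l) * (1 / 2)"
    by (rule sums_unique[OF sums_mult2[OF exp_sums_divide], symmetric])
  also have "(\<lambda>x. \<Sum>m. (- l) ^ m / fact m * ?A m x) = (\<lambda>x. exp (- l) * h x 0)"
    using sums_unique[OF compound_poisson_inversion[OF l rG hm habs]] unfolding \<nu>_def by simp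
  finally have "((\<lambda>x. exp (- l) * h x 0) \<longlongrightarrow> exp (- l) * (1 / 2)) at_top" .
  then have "((\<lambda>x. exp l * (exp (- l) * h x 0)) \<longlongrightarrow> exp l * (exp (- l) * (1 / 2))) at_top"
    by (rule tendsto_mult[OF tendsto_const])
  moreover have "exp l * (exp (- l) * u) = u" for u :: real
    by (simp add: mult_exp_exp flip: mult.assoc)
  ultimately have "((\<lambda>x. h x 0) \<longlongrightarrow> 1 / 2) at_top" by (simp only:)
  moreover have "\<forall>\<^sub>F x in at_top. h x 0 = ratio \<nu> x"
    using clip[of 0] by (rule eventually_mono) (simp add: g_def ratio_def)
  ultimately show ?thesis unfolding \<nu>_def by (rule Lim_transform_eventually)
qed

end

section \<open>Passing between a compound Poisson distribution and its Levy measure\<close>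

lemma long_tailed_local_transfer:
  assumes M: "long_tailed_local c S M" and rN: "real_distribution N" and a: "0 < a"
    and lim: "((\<lambda>x. local_mass N c x / local_mass M c x) \<longlongrightarrow> a) at_top"
  shows "long_tailed_local c S N"
proof -
  interpret long_tailed_local c S M by (rule M)
  have lim': "(ratio N \<longlongrightarrow> a) at_top" using lim by (simp add: ratio_def[abs_def])
  have "\<forall>\<^sub>F x in at_top. a / 2 < ratio N x"
    by (rule order_tendstoD(1)[OF lim']) (use a in simp)
  moreover have "\<forall>\<^sub>F x in at_top. ratio N x < 2 * a"
    by (rule order_tendstoD(2)[OF lim']) (use a in simp)
  ultimately have "\<forall>\<^sub>F x in at_top. 0 < \<alpha> x \<and> a / 2 * \<alpha> x < local_mass N c x \<and> local_mass N c x < 2 * a * \<alpha> x"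
    using eventually_pos
    by eventually_elim (simp add: ratio_def less_divide_eq divide_less_eq)
  then obtain u where u: "\<And>x. u \<le> x \<Longrightarrow> 0 < \<alpha> x"
    "\<And>x. u \<le> x \<Longrightarrow> a / 2 * \<alpha> x < local_mass N c x"
    "\<And>x. u \<le> x \<Longrightarrow> local_mass N c x < 2 * a * \<alpha> x"
    by (auto simp: eventually_at_top_linorder)
  have pos: "0 < local_mass N c x" if "u \<le> x" for x
  proof -
    have "0 < a / 2 * \<alpha> x" using a u(1)[OF that] by simp
    then show ?thesis using u(2)[OF that] by linarith
  qed
  have "(\<lambda>x. local_mass N c (x + y)) \<sim>[at_top] local_mass N c" for y
  proof (rule asymp_equivI')
    have "((\<lambda>x. (local_mass N c (x - - y) / \<alpha> x) / ratio N x) \<longlongrightarrow> a / a) at_top"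
      by (intro tendsto_divide ratio_shift_tendsto lim') (use a in simp)
    moreover have "\<forall>\<^sub>F x in at_top. (local_mass N c (x - - y) / \<alpha> x) / ratio N x
        = local_mass N c (x + y) / local_mass N c x"
      using eventually_pos by eventually_elim (simp add: ratio_def)
    ultimately show "((\<lambda>x. local_mass N c (x + y) / local_mass N c x) \<longlongrightarrow> 1) at_top"
      using a by (simp add: Lim_transform_eventually)
  qed
  moreover have "\<exists>x0>0. \<forall>x\<ge>x0. 0 < local_mass N c x"
    using pos by (intro exI[of _ "max 1 u"]) auto
  ultimately have L: "N \<in> L_Delta c"
    using rN borel_measurable_local_mass[OF rN c] by (simp add: L_Delta_def L_fun_def local_mass_nonneg)
  have "almost_decreasing (local_mass N c)" if ad: "almost_decreasing \<alpha>"
  proof -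
    obtain x0 K where K: "0 < x0" "0 < K" "\<And>x y. x0 < x \<Longrightarrow> 0 < y \<Longrightarrow> \<alpha> (x + y) \<le> K * \<alpha> x"
      using ad unfolding almost_decreasing_def by blast
    have "local_mass N c (x + y) \<le> 4 * K * local_mass N c x" if x: "max x0 u < x" and y: "0 < y" for x y
    proof -
      have "local_mass N c (x + y) \<le> 2 * a * \<alpha> (x + y)"
        using u(3)[of "x + y"] x y by simp
      also have "\<dots> \<le> 2 * a * (K * \<alpha> x)"
        using K(3)[of x y] x y a by (intro mult_left_mono) auto
      also have "\<dots> = 4 * K * (a / 2 * \<alpha> x)" by simp
      also have "\<dots> \<le> 4 * K * local_mass N c x"
        using u(2)[of x] x K(2) by (intro mult_left_mono) auto
      finally show ?thesis .
    qed
    then show ?thesis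
      unfolding almost_decreasing_def using K(1,2)
      by (intro conjI allI local_mass_nonneg exI[of _ "max x0 u"] exI[of _ "4 * K"]) auto
  qed
  with L S c show ?thesis by unfold_locales auto
qed

lemma locally_subexponentialI:
  assumes "long_tailed_local c S M" and "carried S M"
    and "((\<lambda>x. local_mass (convolution M M) c x / local_mass M c x) \<longlongrightarrow> 2) at_top"
  shows "locally_subexponential c S M"
proof -
  interpret long_tailed_local c S M by fact
  show ?thesis
    by unfold_locales (use assms(2,3) in \<open>simp_all add: ratio_def[abs_def]\<close>)
qed

lemma locally_subexponential_compound_poisson:
  assumes l: "0 < l" and G: "locally_subexponential c S G"
  shows "locally_subexponential c S (compound_poisson l G)"
    and "((\<lambda>x. local_mass (compound_poisson l G) c x / local_mass G c x) \<longlongrightarrow> l) at_top"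
proof -
  interpret locally_subexponential c S G by (rule G)
  have l2: "0 < l + l" using l by simp
  note lim = ratio_compound_poisson_tendsto[OF l]
  note lim2 = ratio_compound_poisson_tendsto[OF l2]
  show lim': "((\<lambda>x. local_mass (compound_poisson l G) c x / local_mass G c x) \<longlongrightarrow> l) at_top"
    using lim by (simp add: ratio_def[abs_def])
  have "((\<lambda>x. ratio (compound_poisson (l + l) G) x / ratio (compound_poisson l G) x) \<longlongrightarrow> (l + l) / l) at_top"
    by (intro tendsto_divide lim lim2) (use l in simp)
  moreover have "\<forall>\<^sub>F x in at_top. ratio (compound_poisson (l + l) G) x / ratio (compound_poisson l G) x
      = local_mass (compound_poisson (l + l) G) c x / local_mass (compound_poisson l G) c x"
    using eventually_pos by eventually_elim (simp add: ratio_def)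
  moreover have "(l + l) / l = 2" using l by (simp add: add_divide_distrib)
  ultimately have "((\<lambda>x. local_mass (compound_poisson (l + l) G) c x / local_mass (compound_poisson l G) c x)
      \<longlongrightarrow> 2) at_top"
    by (simp only: Lim_transform_eventually)
  then show "locally_subexponential c S (compound_poisson l G)"
    unfolding compound_poisson_convolution[OF l l real_distribution_M, symmetric]
    by (intro locally_subexponentialI long_tailed_local_transfer[OF long_tailed_local_axioms _ l lim']
        real_distribution_compound_poisson[OF l real_distribution_M] carried_compound_poisson[OF S_cases l carried_M])
qed

text \<open>
  Each halving step reproduces its own hypothesis: once \<open>\<nu> \<sim> (\<nu> * \<nu>) / 2\<close> is known, \<open>\<nu>\<close> inherits the long
  tail of \<open>\<nu> * \<nu>\<close>, and the same relation read backwards says that \<open>\<nu>\<close> is subexponential.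
\<close>

lemma locally_subexponential_dyadic_root:
  assumes l: "0 < l" and G: "carried S G" and sub: "locally_subexponential c S (compound_poisson l G)"
  shows "locally_subexponential c S (compound_poisson (l / 2 ^ k) G) \<and>
    ((\<lambda>x. local_mass (compound_poisson (l / 2 ^ k) G) c x / local_mass (compound_poisson l G) c x)
      \<longlongrightarrow> 1 / 2 ^ k) at_top"
proof (induction k)
  case 0
  interpret locally_subexponential c S "compound_poisson l G" by (rule sub)
  show ?case using sub ratio_self_tendsto by (simp add: ratio_def[abs_def])
next
  case (Suc k)
  define s where "s = l / 2 ^ Suc k"
  have s: "0 < s" and s2: "l / 2 ^ k = 2 * s" using l by (auto simp: s_def)
  have rG: "real_distribution G" using G by (simp add: carried_def)
  let ?N = "compound_poisson s G" and ?M = "compound_poisson (2 * s) G"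
  interpret M: locally_subexponential c S ?M using Suc.IH unfolding s2 by blast
  have half: "((\<lambda>x. local_mass ?N c x / local_mass ?M c x) \<longlongrightarrow> 1 / 2) at_top"
    using M.half_ratio_tendsto[OF s G refl] by (simp add: M.ratio_def[abs_def])
  have conv: "convolution ?N ?N = ?M"
    unfolding mult_2 by (rule compound_poisson_convolution[OF s s rG])
  have "((\<lambda>x. inverse (local_mass ?N c x / local_mass ?M c x)) \<longlongrightarrow> inverse (1 / 2)) at_top"
    by (intro tendsto_inverse half) simp
  then have "((\<lambda>x. local_mass (convolution ?N ?N) c x / local_mass ?N c x) \<longlongrightarrow> 2) at_top"
    unfolding conv by simp
  then have subN: "locally_subexponential c S ?N"
    by (intro locally_subexponentialI long_tailed_local_transfer[OF M.long_tailed_local_axioms _ _ half]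
        real_distribution_compound_poisson[OF s rG] carried_compound_poisson[OF M.S_cases s G]) simp
  have "((\<lambda>x. (local_mass ?N c x / local_mass ?M c x) * (local_mass ?M c x / local_mass (compound_poisson l G) c x))
      \<longlongrightarrow> 1 / 2 * (1 / 2 ^ k)) at_top"
    using Suc.IH unfolding s2 by (intro tendsto_mult half) blast
  moreover have "\<forall>\<^sub>F x in at_top.
      (local_mass ?N c x / local_mass ?M c x) * (local_mass ?M c x / local_mass (compound_poisson l G) c x)
      = local_mass ?N c x / local_mass (compound_poisson l G) c x"
    using M.eventually_pos by eventually_elim simp
  ultimately have "((\<lambda>x. local_mass ?N c x / local_mass (compound_poisson l G) c x)
      \<longlongrightarrow> 1 / 2 * (1 / 2 ^ k)) at_top"
    by (rule Lim_transform_eventually)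
  with subN show ?case unfolding s_def by simp
qed

text \<open>
  Away from \<open>0\<close> the series of \<open>e\<^sup>l\<^sup>/\<^sup>n\<close> times the compound Poisson distribution of intensity \<open>l/n\<close> starts
  with \<open>(l/n) G\<close>; in the remaining terms \<open>(l/n)\<^sup>j \<le> l\<^sup>j / n\<^sup>2\<close>, so they are controlled by the distribution
  of intensity \<open>l\<close>.
\<close>

lemma compound_poisson_small_intensity:
  assumes l: "0 < l" and n: "1 \<le> n" and G: "real_distribution G" and A: "A \<in> sets borel" "0 \<notin> A"
  shows "\<bar>l / n * measure G A - exp (l / n) * measure (compound_poisson (l / n) G) A\<bar>
    \<le> exp l / n\<^sup>2 * measure (compound_poisson l G) A"
proof -
  let ?b = "\<lambda>j. measure (conv_power G j) A"
  define f where "f j = (l / n) ^ j / fact j * ?b j" for j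
  define g where "g j = 1 / n\<^sup>2 * (l ^ j / fact j * ?b j)" for j
  have ln: "0 < l / n" using l n by simp
  have f: "f sums (exp (l / n) * measure (compound_poisson (l / n) G) A)"
    unfolding f_def[abs_def] by (rule measure_compound_poisson_sums[OF ln G A(1)])
  have g: "g sums (1 / n\<^sup>2 * (exp l * measure (compound_poisson l G) A))"
    unfolding g_def[abs_def] by (intro sums_mult measure_compound_poisson_sums[OF l G A(1)])
  have f0: "0 \<le> f j" and g0: "0 \<le> g j" for j using l n by (auto simp: f_def g_def)
  have "?b 0 = 0" using A by (simp add: measure_return)
  then have f01: "f 0 = 0" "f 1 = l / n * measure G A"
    using conv_power_1[OF G] by (auto simp: f_def)
  have "(\<lambda>j. f (j + 2)) sums (exp (l / n) * measure (compound_poisson (l / n) G) A - (\<Sum>j<2. f j))"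
    by (rule sums_split_initial_segment[OF f])
  then have f2: "(\<lambda>j. f (j + 2)) sums (exp (l / n) * measure (compound_poisson (l / n) G) A - l / n * measure G A)"
    using f01 by (simp add: numeral_2_eq_2)
  have g2: "(\<lambda>j. g (j + 2)) sums (1 / n\<^sup>2 * (exp l * measure (compound_poisson l G) A) - (\<Sum>j<2. g j))"
    by (rule sums_split_initial_segment[OF g])
  have "f (j + 2) \<le> g (j + 2)" for j
  proof -
    have "n ^ 2 \<le> n ^ (j + 2)" using n by (intro power_increasing) auto
    then have "l ^ (j + 2) / n ^ (j + 2) \<le> l ^ (j + 2) / n\<^sup>2"
      using l n by (intro divide_left_mono) auto
    then have "l ^ (j + 2) / n ^ (j + 2) * (?b (j + 2) / fact (j + 2)) \<le> l ^ (j + 2) / n\<^sup>2 * (?b (j + 2) / fact (j + 2))"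
      by (intro mult_right_mono) auto
    then show ?thesis unfolding f_def g_def power_divide by (simp only: times_divide_eq_left times_divide_eq_right mult_1_left divide_divide_eq_left mult.commute)
  qed
  then have "exp (l / n) * measure (compound_poisson (l / n) G) A - l / n * measure G A
      \<le> 1 / n\<^sup>2 * (exp l * measure (compound_poisson l G) A) - (\<Sum>j<2. g j)"
    by (rule sums_le[OF _ f2 g2])
  moreover have "0 \<le> (\<Sum>j<2. g j)" using g0 by (intro sum_nonneg) auto
  moreover have "0 \<le> exp (l / n) * measure (compound_poisson (l / n) G) A - l / n * measure G A"
    by (rule sums_le[OF _ sums_zero f2]) (rule f0)
  ultimately show ?thesis by simp
qed

text \<open>
  For fixed \<open>n = 2\<^sup>k\<close> the root of order \<open>n\<close> is asymptotic to \<open>1/n\<close> of the whole, which pins \<open>l G\<close> divided by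
  the whole to within \<open>e\<^sup>l / n\<close> of \<open>e\<^sup>l\<^sup>/\<^sup>n\<close>. Both tolerances vanish as \<open>k\<close> grows.
\<close>

lemma levy_measure_ratio_tendsto:
  assumes l: "0 < l" and G: "carried S G" and sub: "locally_subexponential c S (compound_poisson l G)"
  shows "((\<lambda>x. local_mass G c x / local_mass (compound_poisson l G) c x) \<longlongrightarrow> 1 / l) at_top"
proof -
  interpret locally_subexponential c S "compound_poisson l G" by (rule sub)
  have rG: "real_distribution G" using G by (simp add: carried_def)
  have "((\<lambda>x. l * ratio G x) \<longlongrightarrow> 1) at_top"
  proof (rule tendstoI)
    fix e :: real assume e: "0 < e"
    have z: "(\<lambda>k. a / 2 ^ k) \<longlonglongrightarrow> (0::real)" for a :: real
      by (rule LIMSEQ_divide_realpow_zero) simp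
    have "(\<lambda>k. exp (l / 2 ^ k)) \<longlonglongrightarrow> exp 0" by (intro tendsto_exp z)
    then have "\<forall>\<^sub>F k in sequentially. dist (exp (l / 2 ^ k)) (exp 0) < e / 4"
      by (rule tendstoD) (use e in simp)
    moreover have "\<forall>\<^sub>F k in sequentially. exp l / 2 ^ k < e / 4"
      by (rule order_tendstoD(2)[OF z]) (use e in simp)
    ultimately have "\<forall>\<^sub>F k in sequentially. dist (exp (l / 2 ^ k)) (exp 0) < e / 4 \<and> exp l / 2 ^ k < e / 4"
      by (rule eventually_conj)
    from eventually_happens'[OF sequentially_bot this]
    obtain k where k: "\<bar>exp (l / 2 ^ k) - 1\<bar> < e / 4" "exp l / 2 ^ k < e / 4"
      by (auto simp: dist_real_def)
    define n :: real where "n = 2 ^ k"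
    have n: "1 \<le> n" by (simp add: n_def)
    let ?R = "\<lambda>x. ratio (compound_poisson (l / n) G) x"
    have "(?R \<longlongrightarrow> 1 / n) at_top"
      using locally_subexponential_dyadic_root[OF l G sub, of k] by (simp add: ratio_def[abs_def] n_def)
    then have "((\<lambda>x. n * exp (l / n) * ?R x) \<longlongrightarrow> n * exp (l / n) * (1 / n)) at_top"
      by (intro tendsto_mult tendsto_const)
    then have "((\<lambda>x. n * exp (l / n) * ?R x) \<longlongrightarrow> exp (l / n)) at_top"
      using n by simp
    then have "\<forall>\<^sub>F x in at_top. dist (n * exp (l / n) * ?R x) (exp (l / n)) < e / 4"
      by (rule tendstoD) (use e in simp)
    then show "\<forall>\<^sub>F x in at_top. dist (l * ratio G x) 1 < e"
      using eventually_pos eventually_ge_at_top[of 0]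
    proof eventually_elim
      case (elim x)
      let ?A = "{x<..x + c}"
      have "\<bar>l / n * measure G ?A - exp (l / n) * measure (compound_poisson (l / n) G) ?A\<bar>
          \<le> exp l / n\<^sup>2 * \<alpha> x"
        unfolding local_mass_def
        by (rule compound_poisson_small_intensity[OF l n rG]) (use elim(3) in auto)
      then have "n * \<bar>l / n * local_mass G c x - exp (l / n) * local_mass (compound_poisson (l / n) G) c x\<bar> / \<alpha> x
          \<le> n * (exp l / n\<^sup>2 * \<alpha> x) / \<alpha> x"
        unfolding local_mass_def[of G] local_mass_def[of "compound_poisson (l / n) G"]
        using elim(2) n by (intro divide_right_mono mult_left_mono) auto
      also have "n * (exp l / n\<^sup>2 * \<alpha> x) / \<alpha> x = exp l / n"
        using elim(2) n by (simp add: power2_eq_square)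
      also have "n * \<bar>l / n * local_mass G c x - exp (l / n) * local_mass (compound_poisson (l / n) G) c x\<bar> / \<alpha> x
          = \<bar>(n * (l / n * local_mass G c x - exp (l / n) * local_mass (compound_poisson (l / n) G) c x)) / \<alpha> x\<bar>"
        using elim(2) n by (simp add: abs_mult)
      also have "(n * (l / n * local_mass G c x - exp (l / n) * local_mass (compound_poisson (l / n) G) c x)) / \<alpha> x
          = l * ratio G x - n * exp (l / n) * ?R x"
        using n by (simp add: ratio_def right_diff_distrib diff_divide_distrib)
      finally have "\<bar>l * ratio G x - n * exp (l / n) * ?R x\<bar> \<le> exp l / n" .
      then show ?case
        using elim(1) k unfolding dist_real_def n_def[symmetric] by linarith
    qed
  qed
  then have "((\<lambda>x. 1 / l * (l * ratio G x)) \<longlongrightarrow> 1 / l * 1) at_top"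
    by (rule tendsto_mult[OF tendsto_const])
  then show ?thesis using l by (simp add: ratio_def[abs_def])
qed

lemma long_tailed_local_iff:
  assumes c: "0 < c"
  shows "long_tailed_local c UNIV F \<longleftrightarrow> F \<in> L_Delta c \<inter> D_Delta c"
    and "long_tailed_local c {0..} F \<longleftrightarrow> F \<in> L_Delta c"
proof -
  have "(UNIV :: real set) \<noteq> {0..}"
    by (metis UNIV_I atLeast_iff neg_0_le_iff_le not_one_le_zero)
  then show "long_tailed_local c UNIV F \<longleftrightarrow> F \<in> L_Delta c \<inter> D_Delta c"
    "long_tailed_local c {0..} F \<longleftrightarrow> F \<in> L_Delta c"
    using c by (auto simp: long_tailed_local_def L_Delta_def D_Delta_def)
qed

lemma locally_subexponential_iff:
  "locally_subexponential c S F \<longleftrightarrow> long_tailed_local c S F \<and> carried S F \<and> F \<in> S_Delta c"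
proof (cases "long_tailed_local c S F")
  case True
  then interpret long_tailed_local c S F .
  have c2: "conv_power F 2 = convolution F F" by (rule conv_power_2[OF real_distribution_M])
  have "(ratio (convolution F F) \<longlongrightarrow> 2) at_top \<longleftrightarrow> F \<in> S_Delta c"
  proof
    assume "(ratio (convolution F F) \<longlongrightarrow> 2) at_top"
    then have "local_mass (convolution F F) c \<sim>[at_top] (\<lambda>x. 2 * \<alpha> x)"
      unfolding ratio_def[abs_def] by (rule asymp_equivI'_const) simp
    then show "F \<in> S_Delta c" using M by (simp add: S_Delta_def c2)
  next
    assume "F \<in> S_Delta c"
    then have "local_mass (convolution F F) c \<sim>[at_top] (\<lambda>x. 2 * \<alpha> x)" by (simp add: S_Delta_def c2)
    then have "((\<lambda>x. local_mass (convolution F F) c x / (2 * \<alpha> x)) \<longlongrightarrow> 1) at_top"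
      by (rule asymp_equivD_strong) (rule eventually_mono[OF eventually_pos], simp)
    then have "((\<lambda>x. 2 * (local_mass (convolution F F) c x / (2 * \<alpha> x))) \<longlongrightarrow> 2 * 1) at_top"
      by (rule tendsto_mult[OF tendsto_const])
    then show "(ratio (convolution F F) \<longlongrightarrow> 2) at_top" by (simp add: ratio_def[abs_def])
  qed
  then show ?thesis
    using long_tailed_local_axioms
    by (auto simp: locally_subexponential_def locally_subexponential_axioms_def)
qed (simp add: locally_subexponential_def)

lemma compound_poisson_equivalence:
  assumes l: "0 < l" and G: "carried S G"
  shows "locally_subexponential c S (compound_poisson l G) \<longleftrightarrow> locally_subexponential c S G"
    and "locally_subexponential c S G \<longleftrightarrow> long_tailed_local c S G \<and>
      ((\<lambda>x. local_mass (compound_poisson l G) c x / local_mass G c x) \<longlongrightarrow> l) at_top"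
proof -
  have 12: "long_tailed_local c S G \<and>
      ((\<lambda>x. local_mass (compound_poisson l G) c x / local_mass G c x) \<longlongrightarrow> l) at_top"
    if sub: "locally_subexponential c S (compound_poisson l G)"
  proof -
    interpret locally_subexponential c S "compound_poisson l G" by (rule sub)
    have rG: "real_distribution G" using G by (simp add: carried_def)
    note lim = levy_measure_ratio_tendsto[OF l G sub]
    have "((\<lambda>x. inverse (local_mass G c x / \<alpha> x)) \<longlongrightarrow> inverse (1 / l)) at_top"
      by (intro tendsto_inverse lim) (use l in simp)
    then have "((\<lambda>x. \<alpha> x / local_mass G c x) \<longlongrightarrow> l) at_top" by simp
    moreover have "long_tailed_local c S G"
      by (rule long_tailed_local_transfer[OF long_tailed_local_axioms rG _ lim]) (use l in simp)
    ultimately show ?thesis by blast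
  qed
  have 23: "locally_subexponential c S G"
    if L: "long_tailed_local c S G"
      and lim: "((\<lambda>x. local_mass (compound_poisson l G) c x / local_mass G c x) \<longlongrightarrow> l) at_top"
  proof -
    interpret long_tailed_local c S G by (rule L)
    have "(ratio (convolution G G) \<longlongrightarrow> 2) at_top"
      by (rule self_convolution_of_compound_poisson[OF l G]) (use lim in \<open>simp add: ratio_def[abs_def]\<close>)
    then show ?thesis by (intro locally_subexponentialI L G) (simp add: ratio_def[abs_def])
  qed
  show "locally_subexponential c S (compound_poisson l G) \<longleftrightarrow> locally_subexponential c S G"
    using 12 23 locally_subexponential_compound_poisson(1)[OF l] by blast
  show "locally_subexponential c S G \<longleftrightarrow> long_tailed_local c S G \<and>
      ((\<lambda>x. local_mass (compound_poisson l G) c x / local_mass G c x) \<longlongrightarrow> l) at_top"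
    using 12 23 locally_subexponential_compound_poisson[OF l] by blast
qed

theorem corollary4p4:
  fixes G \<mu> :: "real measure" and l :: real
  assumes "l > 0"
    and "real_distribution G"
    and "\<mu> = compound_poisson l G"
  shows "(\<mu> \<in> S_loc \<inter> D_loc \<longleftrightarrow> G \<in> S_loc \<inter> D_loc) \<and>
         (G \<in> S_loc \<inter> D_loc \<longleftrightarrow>
            G \<in> L_loc \<inter> D_loc \<and>
            (\<forall>c>0. ((\<lambda>x. local_mass \<mu> c x / local_mass G c x) \<longlongrightarrow> l) at_top)) \<and>
         (measure G {0..} = 1 \<longrightarrow>
            (\<mu> \<in> S_loc \<longleftrightarrow> G \<in> S_loc) \<and>
            (G \<in> S_loc \<longleftrightarrow>
               G \<in> L_loc \<and>
               (\<forall>c>0. ((\<lambda>x. local_mass \<mu> c x / local_mass G c x) \<longlongrightarrow> l) at_top)))"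
proof -
  have r\<mu>: "real_distribution \<mu>"
    unfolding assms(3) by (rule real_distribution_compound_poisson[OF assms(1,2)])
  have S_sub: "S_Delta c \<subseteq> L_Delta c" for c by (auto simp: S_Delta_def)
  have two: "locally_subexponential c UNIV F \<longleftrightarrow> F \<in> S_Delta c \<inter> D_Delta c"
    if "0 < c" "real_distribution F" for c F
    using that S_sub[of c] by (auto simp: locally_subexponential_iff long_tailed_local_iff carried_UNIV)
  have one: "locally_subexponential c {0..} F \<longleftrightarrow> F \<in> S_Delta c"
    if "0 < c" "carried {0..} F" for c F
    using that S_sub[of c] by (auto simp: locally_subexponential_iff long_tailed_local_iff)
  have loc: "F \<in> S_loc \<inter> D_loc \<longleftrightarrow> (\<forall>c>0. F \<in> S_Delta c \<inter> D_Delta c)"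
    "F \<in> L_loc \<inter> D_loc \<longleftrightarrow> (\<forall>c>0. F \<in> L_Delta c \<inter> D_Delta c)"
    "F \<in> S_loc \<longleftrightarrow> (\<forall>c>0. F \<in> S_Delta c)" "F \<in> L_loc \<longleftrightarrow> (\<forall>c>0. F \<in> L_Delta c)" for F
    by (auto simp: S_loc_def D_loc_def L_loc_def)
  have cU: "carried UNIV G" using assms(2) by (simp add: carried_UNIV)
  have eqU: "\<mu> \<in> S_Delta c \<inter> D_Delta c \<longleftrightarrow> G \<in> S_Delta c \<inter> D_Delta c"
    "G \<in> S_Delta c \<inter> D_Delta c \<longleftrightarrow> G \<in> L_Delta c \<inter> D_Delta c \<and>
      ((\<lambda>x. local_mass \<mu> c x / local_mass G c x) \<longlongrightarrow> l) at_top" if c: "0 < c" for c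
    using compound_poisson_equivalence[OF assms(1) cU, of c]
    unfolding assms(3)[symmetric] two[OF c r\<mu>] two[OF c assms(2)] long_tailed_local_iff(1)[OF c]
    by blast+
  have eq0: "\<mu> \<in> S_Delta c \<longleftrightarrow> G \<in> S_Delta c"
    "G \<in> S_Delta c \<longleftrightarrow> G \<in> L_Delta c \<and>
      ((\<lambda>x. local_mass \<mu> c x / local_mass G c x) \<longlongrightarrow> l) at_top"
    if c: "0 < c" and m: "measure G {0..} = 1" for c
  proof -
    have c0: "carried {0..} G" using assms(2) m by (simp add: carried_nonneg_iff)
    have c\<mu>: "carried {0..} \<mu>"
      unfolding assms(3) by (rule carried_compound_poisson[OF _ assms(1) c0]) simp
    show "\<mu> \<in> S_Delta c \<longleftrightarrow> G \<in> S_Delta c"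
      "G \<in> S_Delta c \<longleftrightarrow> G \<in> L_Delta c \<and>
        ((\<lambda>x. local_mass \<mu> c x / local_mass G c x) \<longlongrightarrow> l) at_top"
      using compound_poisson_equivalence[OF assms(1) c0, of c]
      unfolding assms(3)[symmetric] one[OF c c\<mu>] one[OF c c0] long_tailed_local_iff(2)[OF c]
      by blast+
  qed
  show ?thesis
    unfolding loc using eqU eq0 by blast
qed

end
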